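(* Let $n = q^{m}-1$, where $q \geq 3$ is a prime power and $m \geq 2$ is an integer. Then for every integer $c$ with $2 \leq c \leq q$ and $(c-1)q+1 < \lfloor q^{\lceil m/2\rceil}-1\rfloor$ there exists a quantum code with parameters $[[n,\; n-m(2c-3)-1,\; d \geq c]]_{q}$.
   Context: An $[[n,K,d]]_q$ quantum code is a $q^{K}$-dimensional complex subspace $Q$ of $(\mathbb{C}^{q})^{\otimes n}$ with minimum distance $d$; "$d\geq c$" means that the minimum distance is at least $c$, i.e. every error operator $E$ acting nontrivially on at most $c-1$ of the $n$ tensor factors is detectable: $PEP=\lambda_E P$ for some scalar $\lambda_E$, where $P$ is the orthogonal projector onto $Q$. *)

theory Defs
  imports
    Complex_Main
    "HOL-Library.FuncSet"
    "HOL-Library.Function_Algebras"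
    "HOL-Number_Theory.Prime_Powers"
begin

text \<open>
  The space of \<open>n\<close> qudits, the \<open>n\<close>-th tensor power of the \<open>q\<close>-dimensional complex space, is
  represented in coordinates: its standard product basis is indexed by the words of length \<open>n\<close>
  over \<open>{..<q}\<close>, and a vector is its family of coordinates, extended by zero to all indices.
\<close>

definition words :: "nat \<Rightarrow> nat \<Rightarrow> (nat \<Rightarrow> nat) set" where
  "words q n = {..<n} \<rightarrow>\<^sub>E {..<q}"

type_synonym qvec = "(nat \<Rightarrow> nat) \<Rightarrow> complex"

definition qscale :: "complex \<Rightarrow> qvec \<Rightarrow> qvec" where
  "qscale a \<psi> = (\<lambda>x. a * \<psi> x)"

interpretation qvec: vector_space qscale
  by unfold_locales (auto simp: qscale_def fun_eq_iff algebra_simps)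

definition qudit_space :: "nat \<Rightarrow> nat \<Rightarrow> qvec set" where
  "qudit_space q n = {\<psi>. \<forall>x. x \<notin> words q n \<longrightarrow> \<psi> x = 0}"

definition qinner :: "nat \<Rightarrow> nat \<Rightarrow> qvec \<Rightarrow> qvec \<Rightarrow> complex" where
  "qinner q n \<phi> \<psi> = (\<Sum>x\<in>words q n. cnj (\<phi> x) * \<psi> x)"

text \<open>Operators are given by their matrices in the product basis; entries outside
  \<open>words q n\<close> are irrelevant.\<close>

type_synonym qop = "(nat \<Rightarrow> nat) \<Rightarrow> (nat \<Rightarrow> nat) \<Rightarrow> complex"

definition qapply :: "nat \<Rightarrow> nat \<Rightarrow> qop \<Rightarrow> qvec \<Rightarrow> qvec" where
  "qapply q n E \<psi> = (\<lambda>x. if x \<in> words q n then \<Sum>y\<in>words q n. E x y * \<psi> y else 0)"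

text \<open>\<open>E\<close> is, up to reordering of the tensor factors, \<open>F \<otimes> I\<close> with \<open>F\<close> an arbitrary operator on the
  factors in \<open>S\<close> and \<open>I\<close> the identity on the others.\<close>

definition acts_only_on :: "nat \<Rightarrow> nat \<Rightarrow> nat set \<Rightarrow> qop \<Rightarrow> bool" where
  "acts_only_on q n S E \<longleftrightarrow>
     (\<exists>F :: qop. \<forall>x\<in>words q n. \<forall>y\<in>words q n.
        E x y = (if \<forall>i\<in>{..<n} - S. x i = y i then F (restrict x S) (restrict y S) else 0))"

text \<open>This determines \<open>P\<close> uniquely on the qudit space.\<close>

definition orthogonal_projector :: "nat \<Rightarrow> nat \<Rightarrow> qvec set \<Rightarrow> (qvec \<Rightarrow> qvec) \<Rightarrow> bool" where
  "orthogonal_projector q n Q P \<longleftrightarrow>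
     (\<forall>\<psi>\<in>qudit_space q n. P \<psi> \<in> Q \<and> (\<forall>\<phi>\<in>Q. qinner q n \<phi> (\<psi> - P \<psi>) = 0))"

definition detectable :: "nat \<Rightarrow> nat \<Rightarrow> (qvec \<Rightarrow> qvec) \<Rightarrow> qop \<Rightarrow> bool" where
  "detectable q n P E \<longleftrightarrow>
     (\<exists>\<mu>. \<forall>\<psi>\<in>qudit_space q n. P (qapply q n E (P \<psi>)) = qscale \<mu> (P \<psi>))"

definition min_distance_at_least :: "nat \<Rightarrow> nat \<Rightarrow> qvec set \<Rightarrow> nat \<Rightarrow> bool" where
  "min_distance_at_least q n Q c \<longleftrightarrow>
     (\<exists>P. orthogonal_projector q n Q P \<and>
        (\<forall>S E. S \<subseteq> {..<n} \<and> card S < c \<and> acts_only_on q n S E \<longrightarrow> detectable q n P E))"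

text \<open>A quantum code with parameters \<open>[[n, K, d \<ge> c]]\<close> over \<open>q\<close>-level systems.\<close>

definition quantum_code :: "nat \<Rightarrow> nat \<Rightarrow> nat \<Rightarrow> nat \<Rightarrow> qvec set \<Rightarrow> bool" where
  "quantum_code q n K c Q \<longleftrightarrow>
     Q \<subseteq> qudit_space q n \<and> qvec.subspace Q \<and> qvec.dim Q = q ^ K \<and>
     min_distance_at_least q n Q c"

end

theory Submission
  imports
    Defs
    "HOL-Computational_Algebra.Polynomial"
    "HOL-Library.Disjoint_Sets"
    "HOL-Library.Real_Mod"
begin

text \<open>
  A Calderbank-Shor-Steane code made from two BCH codes, in a combinatorial form. Let \<open>C\<close> be a set of
  words in which two words agreeing outside fewer than \<open>c\<close> positions are equal, partitioned into
  orthogonal arrays of strength \<open>c - 1\<close>. The indicator vectors of the arrays span a code of distance at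
  least \<open>c\<close>: an operator on fewer than \<open>c\<close> factors has no matrix entries between different words of
  \<open>C\<close>, and its diagonal averages to the same value over each array.

  Index the positions by the powers of an element \<open>z\<close> of order \<open>n = q ^ m - 1\<close> in the field of order
  \<open>q ^ m\<close>. The set \<open>C\<close> is a fibre of the map taking \<open>x\<close> to its syndromes \<open>\<Sum>i. x i * z ^ (i * k)\<close>
  for \<open>1 \<le> k < c\<close>, and the arrays are the cosets of the words with letters \<open>tr (f (z ^ i))\<close>, where \<open>f\<close>
  runs through the polynomials of degree at most \<open>c - 2\<close>. Polynomial interpolation gives both the
  distance of \<open>C\<close> and the strength of the arrays.

  The field is realised as \<open>int poly\<close> modulo a maximal ideal \<open>M\<close> that contains \<open>p\<close> and all polynomials
  vanishing at a primitive complex \<open>n\<close>-th root of unity \<open>\<zeta>\<close>; this works because \<open>p\<close> is not a unit in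
  \<open>\<int>[\<zeta>]\<close>. If \<open>z = X\<close> had smaller order \<open>i\<close>, then the sum of the \<open>X ^ (i * k)\<close> over \<open>k < n\<close>, which
  vanishes at \<open>\<zeta>\<close>, would be congruent to \<open>n\<close>, a unit modulo \<open>p\<close>.
\<close>

subsection \<open>Codes from orthogonal arrays\<close>

lemma finite_words [simp]: "finite (words q n)"
  by (simp add: words_def finite_PiE)

text \<open>Grouping the words of \<open>D\<close> by their restriction to \<open>S\<close>, every
  pattern occurs \<open>l\<close> times. The constant \<open>f\<close> then gives the size of
  \<open>D\<close>, and the diagonal entries of an operator give its average over
  \<open>D\<close>.\<close>

lemma sum_orthogonal_array:
  fixes f :: "(nat \<Rightarrow> nat) \<Rightarrow> complex"
  assumes D: "D \<subseteq> words q n" and S: "S \<subseteq> {..<n}"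
    and l: "\<And>w. w \<in> S \<rightarrow>\<^sub>E {..<q} \<Longrightarrow> card {y \<in> D. restrict y S = w} = l"
  shows "(\<Sum>y\<in>D. f (restrict y S)) = of_nat l * (\<Sum>w\<in>S \<rightarrow>\<^sub>E {..<q}. f w)"
proof -
  have fin: "finite D" using D finite_subset finite_words by blast
  have finS: "finite S" using S finite_subset by blast
  have mem: "restrict y S \<in> S \<rightarrow>\<^sub>E {..<q}" if "y \<in> D" for y
  proof -
    have "y \<in> {..<n} \<rightarrow>\<^sub>E {..<q}" using that D by (auto simp: words_def)
    then show ?thesis using S by auto
  qed
  have "(\<Sum>y\<in>D. f (restrict y S)) =
      (\<Sum>w\<in>S \<rightarrow>\<^sub>E {..<q}. \<Sum>y\<in>{y \<in> D. restrict y S = w}. f (restrict y S))"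
    using mem by (intro sum.group[symmetric] fin finite_PiE finS image_subsetI) auto
  also have "\<dots> = (\<Sum>w\<in>S \<rightarrow>\<^sub>E {..<q}. of_nat l * f w)"
    by (intro sum.cong) (auto simp flip: l)
  finally show ?thesis by (simp add: sum_distrib_left)
qed

lemma sum_qvec_apply: "(\<Sum>a\<in>A. f a) x = (\<Sum>a\<in>A. f a x)" for f :: "'b \<Rightarrow> qvec"
  by (induction A rule: infinite_finite_induct) auto

text \<open>These are the Knill-Laflamme conditions in the orthogonal basis of indicator vectors:
  \<open>dist\<close> rules out contributions from pairs of different words, and
  \<open>array\<close> gives every basis vector the same diagonal value.\<close>

lemma quantum_code_from_orthogonal_arrays:
  fixes \<D> :: "(nat \<Rightarrow> nat) set set"
  assumes card: "card \<D> = q ^ K" and q: "q > 0"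
    and sub: "\<And>D. D \<in> \<D> \<Longrightarrow> D \<subseteq> words q n" and ne: "\<And>D. D \<in> \<D> \<Longrightarrow> D \<noteq> {}"
    and disj: "disjoint \<D>"
    and dist: "\<And>x y S. \<lbrakk>x \<in> \<Union>\<D>; y \<in> \<Union>\<D>; S \<subseteq> {..<n}; card S < c;
                 \<forall>i\<in>{..<n} - S. x i = y i\<rbrakk> \<Longrightarrow> x = y"
    and array: "\<And>D S. \<lbrakk>D \<in> \<D>; S \<subseteq> {..<n}; card S < c\<rbrakk> \<Longrightarrow>
                 \<exists>l. \<forall>w \<in> S \<rightarrow>\<^sub>E {..<q}. card {y \<in> D. restrict y S = w} = l"
  shows "quantum_code q n K c (qvec.span ((\<lambda>D x. of_bool (x \<in> D)) ` \<D>))"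
proof -
  define e :: "(nat \<Rightarrow> nat) set \<Rightarrow> qvec" where "e = (\<lambda>D x. of_bool (x \<in> D))"
  let ?Q = "qvec.span (e ` \<D>)"
  have fin\<D>: "finite \<D>" using card q by (metis card.infinite power_not_zero not_gr_zero)
  have finD: "finite D" if "D \<in> \<D>" for D using sub[OF that] finite_subset finite_words by blast
  have cardD: "of_nat (card D) \<noteq> (0::complex)" if "D \<in> \<D>" for D
    using finD[OF that] ne[OF that] by auto
  have other: "x \<notin> D'" if "D \<in> \<D>" "D' \<in> \<D>" "D' \<noteq> D" "x \<in> D" for D D' x
    using disj that by (auto simp: disjoint_def)
  have sum_e: "(\<Sum>D\<in>\<D>. a D * e D x) = a D" if "D \<in> \<D>" "x \<in> D" for D x and a :: "_ \<Rightarrow> complex"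
  proof -
    have "(\<Sum>D'\<in>\<D>. a D' * e D' x) = (\<Sum>D'\<in>\<D>. if D' = D then a D' else 0)"
      using other that by (intro sum.cong) (auto simp: e_def)
    with that fin\<D> show ?thesis by simp
  qed
  have Q_space: "?Q \<subseteq> qudit_space q n"
  proof (rule qvec.span_minimal)
    show "e ` \<D> \<subseteq> qudit_space q n" using subsetD[OF sub] by (fastforce simp: e_def qudit_space_def)
    show "qvec.subspace (qudit_space q n)"
      by (auto simp: qvec.subspace_def qudit_space_def qscale_def)
  qed
  have inj: "inj_on e \<D>"
  proof (rule inj_onI)
    fix D D' assume "D \<in> \<D>" "D' \<in> \<D>" "e D = e D'"
    then have "x \<in> D \<longleftrightarrow> x \<in> D'" for x
      by (metis (mono_tags, lifting) e_def of_bool_eq_iff)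
    then show "D = D'" by auto
  qed
  have indep: "\<not> qvec.dependent (e ` \<D>)"
  proof (rule qvec.independent_if_scalars_zero)
    show "finite (e ` \<D>)" using fin\<D> by simp
    fix f and x
    assume 0: "(\<Sum>x\<in>e ` \<D>. qscale (f x) x) = 0" and "x \<in> e ` \<D>"
    then obtain D where D: "D \<in> \<D>" "x = e D" by auto
    obtain y where y: "y \<in> D" using ne D by blast
    have "0 = (\<Sum>x\<in>e ` \<D>. qscale (f x) x) y" unfolding 0 by simp
    also have "\<dots> = (\<Sum>D\<in>\<D>. f (e D) * e D y)"
      by (simp add: sum_qvec_apply qscale_def sum.reindex[OF inj])
    finally show "f x = 0" using sum_e[OF D(1) y, of "\<lambda>D. f (e D)"] D by simp
  qed
  have dim: "qvec.dim ?Q = q ^ K"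
    using qvec.dim_span_eq_card_independent[OF indep] card card_image[OF inj] by simp
  \<comment> \<open>The basis vectors \<open>e D\<close> are orthogonal with squared norm
    \<open>card D\<close>, so projecting means replacing \<open>\<psi>\<close> on each array by its
    average there.\<close>
  define P :: "qvec \<Rightarrow> qvec"
    where "P \<psi> = (\<Sum>D\<in>\<D>. qscale ((\<Sum>y\<in>D. \<psi> y) / of_nat (card D)) (e D))" for \<psi>
  have P_in: "P \<psi> x = (\<Sum>y\<in>D. \<psi> y) / of_nat (card D)" if "D \<in> \<D>" "x \<in> D" for \<psi> x D
    using sum_e[OF that, of "\<lambda>D. (\<Sum>y\<in>D. \<psi> y) / of_nat (card D)"]
    by (simp add: P_def sum_qvec_apply qscale_def)
  have P_out: "P \<psi> x = 0" if "x \<notin> \<Union>\<D>" for \<psi> x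
    using that by (auto simp: P_def sum_qvec_apply qscale_def e_def intro!: sum.neutral)
  have P_Q: "P \<psi> \<in> ?Q" for \<psi>
    unfolding P_def by (intro qvec.span_sum qvec.span_scale qvec.span_base) auto
  have ortho: "qinner q n \<phi> (\<psi> - P \<psi>) = 0" if "\<phi> \<in> ?Q" for \<phi> \<psi>
    using that
  proof (induction rule: qvec.span_induct_alt)
    case base
    then show ?case by (simp add: qinner_def)
  next
    case (step a x z)
    then obtain D where D: "D \<in> \<D>" "x = e D" by auto
    have "qinner q n x (\<psi> - P \<psi>) = (\<Sum>y\<in>words q n. if y \<in> D then \<psi> y - P \<psi> y else 0)"
      unfolding qinner_def D by (intro sum.cong) (auto simp: e_def)
    also have "\<dots> = (\<Sum>y\<in>words q n \<inter> D. \<psi> y - P \<psi> y)"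
      using sum.inter_restrict[OF finite_words] by metis
    also have "words q n \<inter> D = D" using sub[OF D(1)] by blast
    also have "(\<Sum>y\<in>D. \<psi> y - P \<psi> y) = (\<Sum>y\<in>D. \<psi> y - (\<Sum>y\<in>D. \<psi> y) / of_nat (card D))"
      using P_in[OF D(1)] by simp
    also have "\<dots> = 0" using cardD[OF D(1)] by (simp add: sum_subtractf)
    finally have "qinner q n x (\<psi> - P \<psi>) = 0" .
    moreover have "qinner q n (qscale a x + z) (\<psi> - P \<psi>)
        = cnj a * qinner q n x (\<psi> - P \<psi>) + qinner q n z (\<psi> - P \<psi>)"
      by (simp add: qinner_def qscale_def sum_distrib_left flip: sum.distrib)
        (simp add: algebra_simps)
    ultimately show ?case using step by (simp only: mult_zero_right add_0)
  qed
  have detect: "detectable q n P E"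
    if S: "S \<subseteq> {..<n}" "card S < c" and E: "acts_only_on q n S E" for S E
  proof -
    obtain F :: qop where F: "\<And>x y. x \<in> words q n \<Longrightarrow> y \<in> words q n \<Longrightarrow>
        E x y = (if \<forall>i\<in>{..<n} - S. x i = y i then F (restrict x S) (restrict y S) else 0)"
      using E unfolding acts_only_on_def by blast
    \<comment> \<open>The normalised trace of \<open>F\<close>; it does not depend on the array
      \<open>D\<close>.\<close>
    define \<mu> where "\<mu> = (\<Sum>w\<in>S \<rightarrow>\<^sub>E {..<q}. F w w) / of_nat (q ^ card S)"
    have "P (qapply q n E (P \<psi>)) x = qscale \<mu> (P \<psi>) x" for \<psi> x
    proof (cases "x \<in> \<Union>\<D>")
      case False
      then show ?thesis by (simp add: P_out qscale_def)
    next
      case True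
      then obtain D where D: "D \<in> \<D>" "x \<in> D" by blast
      obtain l where l: "\<And>w. w \<in> S \<rightarrow>\<^sub>E {..<q} \<Longrightarrow> card {y \<in> D. restrict y S = w} = l"
        using array[OF D(1) S] by blast
      \<comment> \<open>Only the diagonal entry at \<open>y\<close> survives:
        \<open>P \<psi>\<close> vanishes outside the arrays, and every other word in them differs
        from \<open>y\<close> somewhere outside \<open>S\<close>. On \<open>D\<close> itself
        \<open>P \<psi>\<close> is constant.\<close>
      have EP: "qapply q n E (P \<psi>) y = F (restrict y S) (restrict y S) * P \<psi> x" if "y \<in> D" for y
      proof -
        have y: "y \<in> words q n" using that sub D by blast
        have eq: "E y z * P \<psi> z = (if z = y then F (restrict y S) (restrict y S) * P \<psi> x else 0)"
          if z: "z \<in> words q n" for z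
        proof (cases "z \<in> \<Union>\<D>")
          case False
          moreover have "z \<noteq> y" using False D \<open>y \<in> D\<close> by blast
          ultimately show ?thesis by (simp add: P_out)
        next
          case True
          show ?thesis
          proof (cases "z = y")
            case True
            then show ?thesis using F[OF y y] P_in[OF D(1)] D \<open>y \<in> D\<close> by simp
          next
            case False
            then show ?thesis using dist[OF _ True S, of y] F[OF y z] D \<open>y \<in> D\<close> by auto
          qed
        qed
        show ?thesis unfolding qapply_def using y by (simp add: eq)
      qed
      have "card D = l * q ^ card S"
      proof -
        have "of_nat (card D) = (of_nat (l * q ^ card S) :: complex)"
          using sum_orthogonal_array[OF sub[OF D(1)] S(1) l, of "\<lambda>_. 1"] S(1) finite_subset[OF S(1)]
          by (simp add: card_PiE)
        then show ?thesis using of_nat_eq_iff by blast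
      qed
      moreover have "card D \<noteq> 0" using cardD[OF D(1)] by auto
      ultimately have "of_nat (card D) = of_nat l * (of_nat (q ^ card S) :: complex)"
        "of_nat l \<noteq> (0::complex)" "of_nat (q ^ card S) \<noteq> (0::complex)" using q by auto
      then show ?thesis
        unfolding P_in[OF D, of "qapply q n E (P \<psi>)"] qscale_def \<mu>_def
        by (simp add: EP flip: sum_distrib_right
            add: sum_orthogonal_array[OF sub[OF D(1)] S(1) l, of "\<lambda>w. F w w"])
    qed
    then show ?thesis unfolding detectable_def by (auto intro!: exI[of _ \<mu>])
  qed
  have "orthogonal_projector q n ?Q P"
    unfolding orthogonal_projector_def using P_Q ortho by blast
  then show ?thesis
    unfolding quantum_code_def min_distance_at_least_def
    using Q_space dim detect by (fold e_def) (auto simp: qvec.subspace_span)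
qed

subsection \<open>A maximal ideal in the polynomials over the integers\<close>

text \<open>A matrix that is diagonal and invertible modulo \<open>p\<close> stays so under Gaussian elimination.\<close>

lemma integer_matrix_kernel:
  fixes v :: "nat \<Rightarrow> complex" and C :: "nat \<Rightarrow> nat \<Rightarrow> int"
  assumes p: "prime (p :: int)"
    and diag: "\<And>i. i < k \<Longrightarrow> \<not> p dvd C i i"
    and off: "\<And>i j. i < k \<Longrightarrow> j < k \<Longrightarrow> i \<noteq> j \<Longrightarrow> p dvd C i j"
    and ker: "\<And>i. i < k \<Longrightarrow> (\<Sum>j<k. of_int (C i j) * v j) = 0"
  shows "\<forall>i<k. v i = 0"
  using diag off ker
proof (induction k arbitrary: C)
  case 0
  then show ?case by simp
next
  case (Suc k)
  \<comment> \<open>Fraction-free elimination of the last unknown with pivot \<open>C k k\<close>.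
    As \<open>p\<close> divides \<open>C i k\<close>, the new diagonal entries are congruent to
    \<open>C k k * C i i\<close> modulo \<open>p\<close>.\<close>
  define C' where "C' i j = C k k * C i j - C i k * C k j" for i j
  have "\<forall>i<k. v i = 0"
  proof (rule Suc.IH[of C'])
    fix i assume i: "i < k"
    have "p dvd C i k" using Suc.prems(2)[of i k] i by simp
    moreover have "\<not> p dvd C k k * C i i" using Suc.prems(1) i p by (simp add: prime_dvd_mult_iff)
    ultimately show "\<not> p dvd C' i i"
      unfolding C'_def by (metis diff_add_cancel dvd_add dvd_mult2)
    have "(\<Sum>j<k. of_int (C i j) * v j) = - of_int (C i k) * v k"
      "(\<Sum>j<k. of_int (C k j) * v j) = - of_int (C k k) * v k"
      using Suc.prems(3)[of i] Suc.prems(3)[of k] i by (auto simp: add_eq_0_iff2)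
    moreover have "(\<Sum>j<k. of_int (C' i j) * v j) =
        of_int (C k k) * (\<Sum>j<k. of_int (C i j) * v j) - of_int (C i k) * (\<Sum>j<k. of_int (C k j) * v j)"
      by (simp add: C'_def sum_distrib_left algebra_simps sum_subtractf)
    ultimately show "(\<Sum>j<k. of_int (C' i j) * v j) = 0" by simp
  next
    fix i j assume "i < k" "j < k" "i \<noteq> j"
    then have "p dvd C i j" "p dvd C i k" using Suc.prems(2) by auto
    then show "p dvd C' i j" unfolding C'_def by simp
  qed
  moreover from this have "of_int (C k k) * v k = 0" using Suc.prems(3)[of k] by simp
  moreover have "C k k \<noteq> 0" using Suc.prems(1)[of k] by auto
  ultimately show ?case by (auto simp: less_Suc_eq)
qed

section \<open>Integer polynomials evaluated at a root of unity\<close>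

definition ev :: "complex \<Rightarrow> int poly \<Rightarrow> complex" where
  "ev \<zeta> f = poly (map_poly of_int f) \<zeta>"

lemma ev_0 [simp]: "ev \<zeta> 0 = 0" by (simp add: ev_def)
lemma ev_pCons [simp]: "ev \<zeta> (pCons a f) = of_int a + \<zeta> * ev \<zeta> f"
  by (simp add: ev_def map_poly_pCons)
lemma ev_1 [simp]: "ev \<zeta> 1 = 1" by (simp add: one_pCons)
lemma ev_add [simp]: "ev \<zeta> (f + g) = ev \<zeta> f + ev \<zeta> g"
  by (induction f g rule: poly_induct2) (simp_all add: algebra_simps)
lemma ev_smult [simp]: "ev \<zeta> (smult a f) = of_int a * ev \<zeta> f"
  by (induction f) (simp_all add: algebra_simps)
lemma ev_minus [simp]: "ev \<zeta> (- f) = - ev \<zeta> f"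
  using ev_smult[of \<zeta> "-1" f] by simp
lemma ev_diff [simp]: "ev \<zeta> (f - g) = ev \<zeta> f - ev \<zeta> g"
  using ev_add[of \<zeta> f "- g"] by simp
lemma ev_mult [simp]: "ev \<zeta> (f * g) = ev \<zeta> f * ev \<zeta> g"
  by (induction f) (simp_all add: algebra_simps)
lemma ev_power [simp]: "ev \<zeta> (f ^ k) = ev \<zeta> f ^ k"
  by (induction k) simp_all
lemma ev_sum [simp]: "ev \<zeta> (\<Sum>i\<in>A. f i) = (\<Sum>i\<in>A. ev \<zeta> (f i))"
  by (induction A rule: infinite_finite_induct) simp_all
lemma ev_of_nat [simp]: "ev \<zeta> (of_nat k) = of_nat k"
  by (induction k) simp_all

text \<open>Exponents can be reduced modulo \<open>n\<close>, so \<int>[\<zeta>] is spanned over the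
  integers by \<open>n\<close> powers of \<zeta>. This turns a question about units into one about
  an integer matrix of size \<open>n\<close>.\<close>

lemma ev_root_of_unity:
  assumes "\<zeta> ^ n = 1" "n > 0"
  shows "\<exists>b :: nat \<Rightarrow> int. ev \<zeta> f = (\<Sum>j<n. of_int (b j) * \<zeta> ^ j)"
proof (induction f)
  case 0
  show ?case by (rule exI[of _ "\<lambda>_. 0"]) simp
next
  case (pCons a f)
  then obtain b where b: "ev \<zeta> f = (\<Sum>j<n. of_int (b j) * \<zeta> ^ j)" by blast
  obtain k where n: "n = Suc k" using assms(2) by (cases n) auto
  \<comment> \<open>Multiplication by \<zeta> shifts the coefficients cyclically: the top one,
    \<open>b k\<close>, returns to the constant term.\<close>
  define b' where "b' j = (if j = 0 then a + b k else b (j - 1))" for j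
  have "ev \<zeta> (pCons a f) = of_int a + (\<Sum>j<k. of_int (b j) * \<zeta> ^ Suc j) + of_int (b k) * \<zeta> ^ n"
    by (simp add: b n sum_distrib_left algebra_simps)
  also have "\<dots> = (\<Sum>j<n. of_int (b' j) * \<zeta> ^ j)"
    unfolding n sum.lessThan_Suc_shift assms(1)[unfolded n] by (simp add: b'_def)
  finally show ?case by blast
qed

text \<open>If \<open>ev \<zeta> g\<close> were an inverse of \<open>p\<close>, let the integer
  matrix \<open>b\<close> describe multiplication by it on the powers of \<zeta>. The matrix
  \<open>C\<close>, the identity minus \<open>p\<close> times \<open>b\<close>, would annihilate the
  vector of these powers. Being the identity modulo \<open>p\<close>, it has trivial kernel, whereas
  the entry \<open>\<zeta> ^ 0\<close> is 1.\<close>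

lemma prime_not_unit_in_cyclotomic_integers:
  assumes p: "prime (p :: nat)" and z: "\<zeta> ^ n = 1" "n > 0"
  shows "of_nat p * ev \<zeta> g \<noteq> 1"
proof
  assume 1: "of_nat p * ev \<zeta> g = 1"
  have "\<exists>b :: nat \<Rightarrow> int. \<zeta> ^ i * ev \<zeta> g = (\<Sum>j<n. of_int (b j) * \<zeta> ^ j)" for i
    using ev_root_of_unity[OF z, of "[:0, 1:] ^ i * g"] by simp
  then obtain b :: "nat \<Rightarrow> nat \<Rightarrow> int"
    where b: "\<And>i. \<zeta> ^ i * ev \<zeta> g = (\<Sum>j<n. of_int (b i j) * \<zeta> ^ j)" by metis
  define C where "C i j = of_bool (i = j) - int p * b i j" for i j
  have "\<forall>i<n. \<zeta> ^ i = 0"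
  proof (rule integer_matrix_kernel[where p = "int p" and C = C])
    show "prime (int p)" using p by simp
    have "\<not> int p dvd 1" using p by (auto simp: prime_nat_iff)
    then show "\<not> int p dvd C i i" for i
      unfolding C_def by (metis diff_add_cancel dvd_add dvd_triv_left of_bool_eq(2))
    show "int p dvd C i j" if "i \<noteq> j" for i j using that by (simp add: C_def)
    fix i assume i: "i < n"
    have "(\<Sum>j<n. of_int (C i j) * \<zeta> ^ j) =
        (\<Sum>j<n. if j = i then \<zeta> ^ j else 0) - of_nat p * (\<Sum>j<n. of_int (b i j) * \<zeta> ^ j)"
      unfolding C_def sum_distrib_left sum_subtractf[symmetric] by (intro sum.cong) (auto simp: algebra_simps)
    also have "\<dots> = \<zeta> ^ i - \<zeta> ^ i * (of_nat p * ev \<zeta> g)"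
      using i by (simp flip: b)
    finally show "(\<Sum>j<n. of_int (C i j) * \<zeta> ^ j) = 0" using 1 by simp
  qed
  then show False using z(2) by (auto dest: spec[of _ 0])
qed

text \<open>Maximality appears as invertibility modulo \<open>M\<close> of everything outside
  \<open>M\<close>. The residue field is handled through congruences in the ring itself, without a
  quotient type.\<close>

locale maximal_ideal =
  fixes M :: "'a::comm_ring_1 set"
  assumes zero_mem: "0 \<in> M"
    and add_mem: "a \<in> M \<Longrightarrow> b \<in> M \<Longrightarrow> a + b \<in> M"
    and mult_mem: "a \<in> M \<Longrightarrow> r * a \<in> M"
    and one_not_mem: "1 \<notin> M"
    and inverse_mem: "a \<notin> M \<Longrightarrow> \<exists>b. a * b - 1 \<in> M"

text \<open>Zorn's lemma for the proper ideals above \<open>J\<close>. For \<open>a\<close> outside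
  a maximal one, the ideal \<open>X\<close> generated by \<open>M\<close> and \<open>a\<close> must
  contain 1, which yields an inverse of \<open>a\<close> modulo \<open>M\<close>.\<close>

lemma exists_maximal_ideal:
  fixes J :: "'a::comm_ring_1 set"
  assumes "0 \<in> J" "\<And>a b. a \<in> J \<Longrightarrow> b \<in> J \<Longrightarrow> a + b \<in> J" "\<And>a r. a \<in> J \<Longrightarrow> r * a \<in> J" "1 \<notin> J"
  obtains M where "maximal_ideal M" "J \<subseteq> M"
proof -
  define \<I> :: "'a set set" where "\<I> = {I. J \<subseteq> I \<and> (\<forall>a\<in>I. \<forall>b\<in>I. a + b \<in> I) \<and> (\<forall>a\<in>I. \<forall>r. r * a \<in> I) \<and> 1 \<notin> I}"
  have "\<exists>M\<in>\<I>. \<forall>X\<in>\<I>. M \<subseteq> X \<longrightarrow> X = M"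
  proof (rule subset_Zorn_nonempty)
    have "J \<in> \<I>" using assms by (simp add: \<I>_def)
    then show "\<I> \<noteq> {}" by blast
    fix \<C> assume ne: "\<C> \<noteq> {}" and ch: "subset.chain \<I> \<C>"
    have sub: "\<C> \<subseteq> \<I>" and tot: "\<And>A B. A \<in> \<C> \<Longrightarrow> B \<in> \<C> \<Longrightarrow> A \<subseteq> B \<or> B \<subseteq> A"
      using ch by (auto simp: subset_chain_def)
    have mem: "J \<subseteq> E" "1 \<notin> E" "a \<in> E \<Longrightarrow> b \<in> E \<Longrightarrow> a + b \<in> E" "a \<in> E \<Longrightarrow> r * a \<in> E"
      if "E \<in> \<C>" for E a b r
      using subsetD[OF sub that] by (auto simp: \<I>_def)
    have "a + b \<in> \<Union>\<C>" if ab: "a \<in> \<Union>\<C>" "b \<in> \<Union>\<C>" for a b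
    proof -
      obtain A B where AB: "A \<in> \<C>" "a \<in> A" "B \<in> \<C>" "b \<in> B" using ab by auto
      then obtain E where "E \<in> \<C>" "a \<in> E" "b \<in> E" using tot[of A B] by blast
      then show ?thesis using mem by blast
    qed
    moreover have "r * a \<in> \<Union>\<C>" if "a \<in> \<Union>\<C>" for r a using that mem by blast
    moreover have "J \<subseteq> \<Union>\<C>" "1 \<notin> \<Union>\<C>" using ne mem by blast+
    ultimately show "\<Union>\<C> \<in> \<I>" by (simp add: \<I>_def)
  qed
  then obtain M where M: "M \<in> \<I>" and max: "\<And>X. X \<in> \<I> \<Longrightarrow> M \<subseteq> X \<Longrightarrow> X = M" by blast
  have "maximal_ideal M"
  proof
    show "0 \<in> M" "1 \<notin> M" "\<And>a b. a \<in> M \<Longrightarrow> b \<in> M \<Longrightarrow> a + b \<in> M" "\<And>a r. a \<in> M \<Longrightarrow> r * a \<in> M"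
      using M assms by (auto simp: \<I>_def)
    note M_props = this
    fix a assume a: "a \<notin> M"
    define X where "X = {x. \<exists>b. x - a * b \<in> M}"
    have MX: "M \<subseteq> X" by (auto simp: X_def intro: exI[of _ 0])
    have "a \<in> X" using M_props(1) by (auto simp: X_def intro: exI[of _ 1])
    with a max MX have "X \<notin> \<I>" by blast
    moreover have "J \<subseteq> X" using M MX by (auto simp: \<I>_def)
    moreover have "x + y \<in> X" if xy: "x \<in> X" "y \<in> X" for x y
    proof -
      obtain b b' where "x - a * b \<in> M" "y - a * b' \<in> M" using xy by (auto simp: X_def)
      then have "(x - a * b) + (y - a * b') \<in> M" by (rule M_props)
      then have "x + y - a * (b + b') \<in> M" by (simp add: algebra_simps)
      then show ?thesis by (auto simp: X_def)
    qed
    moreover have "r * x \<in> X" if x: "x \<in> X" for r x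
    proof -
      obtain b where "x - a * b \<in> M" using x by (auto simp: X_def)
      then have "r * (x - a * b) \<in> M" by (rule M_props)
      then have "r * x - a * (r * b) \<in> M" by (simp add: algebra_simps)
      then show ?thesis by (auto simp: X_def)
    qed
    ultimately have "1 \<in> X" by (auto simp: \<I>_def)
    then obtain b where "1 - a * b \<in> M" by (auto simp: X_def)
    then have "- 1 * (1 - a * b) \<in> M" by (rule M_props)
    then show "\<exists>b. a * b - 1 \<in> M" by auto
  qed
  moreover have "J \<subseteq> M" using M by (simp add: \<I>_def)
  ultimately show ?thesis by (rule that)
qed

lemma exists_cyclotomic_maximal_ideal:
  assumes p: "prime (p :: nat)" and n: "n > 0"
  obtains M :: "int poly set" where "maximal_ideal M" "of_nat p \<in> M"
    "[:0, 1:] ^ n - 1 \<in> M"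
    "\<And>i. 0 < i \<Longrightarrow> i < n \<Longrightarrow> (\<Sum>k<n. ([:0, 1:] ^ i) ^ k) \<in> M"
proof -
  define \<zeta> where "\<zeta> = cis (2 * pi / n)"
  have root: "\<zeta> ^ n = 1" using n by (simp add: \<zeta>_def DeMoivre)
  have prim: "\<zeta> ^ i \<noteq> 1" if i: "0 < i" "i < n" for i
  proof
    assume "\<zeta> ^ i = 1"
    then have "cis (i * (2 * pi / n)) = 1" by (simp add: \<zeta>_def DeMoivre)
    then obtain k :: int where "real i * (2 * pi / n) = k * (2 * pi)" by (auto simp: cis_eq_1_iff)
    then have "real i = k * real n" using n by (simp add: field_simps)
    then have k: "int i = k * int n" by (metis of_int_eq_iff of_int_mult of_int_of_nat_eq)
    then have "int n dvd int i" by simp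
    then have "n dvd i" by simp
    with i show False by (auto dest: dvd_imp_le)
  qed
  \<comment> \<open>The preimage under evaluation of the ideal of \<int>[\<zeta>] generated by
    \<open>p\<close>. It contains every polynomial vanishing at \<zeta>, and it is proper because
    \<open>p\<close> is not a unit there.\<close>
  define J where "J = {f. \<exists>g. ev \<zeta> f = of_nat p * ev \<zeta> g}"
  have kernel: "f \<in> J" if "ev \<zeta> f = 0" for f using that by (auto simp: J_def intro: exI[of _ 0])
  obtain M where M: "maximal_ideal M" "J \<subseteq> M"
  proof (rule exists_maximal_ideal[of J])
    show "0 \<in> J" by (rule kernel) simp
    show "a + b \<in> J" if "a \<in> J" "b \<in> J" for a b
    proof -
      from that obtain g h where "ev \<zeta> a = of_nat p * ev \<zeta> g" "ev \<zeta> b = of_nat p * ev \<zeta> h"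
        by (auto simp: J_def)
      then show ?thesis by (auto simp: J_def distrib_left intro!: exI[of _ "g + h"])
    qed
    show "r * a \<in> J" if "a \<in> J" for a r
    proof -
      from that obtain g where "ev \<zeta> a = of_nat p * ev \<zeta> g" by (auto simp: J_def)
      then show ?thesis by (auto simp: J_def intro!: exI[of _ "r * g"])
    qed
    show "1 \<notin> J" using prime_not_unit_in_cyclotomic_integers[OF p root n] by (fastforce simp: J_def)
  qed
  have geo: "(\<Sum>k<n. (\<zeta> ^ i) ^ k) = 0" if "0 < i" "i < n" for i
    using geometric_sum[OF prim[OF that], of n] root by (simp flip: power_mult add: mult.commute[of i]) (simp add: power_mult)
  show ?thesis
  proof (rule that[OF M(1)])
    show "of_nat p \<in> M" using M(2) by (auto simp: J_def intro!: exI[of _ 1] subsetD[OF M(2)])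
    show "[:0, 1:] ^ n - 1 \<in> M" by (intro subsetD[OF M(2)] kernel) (simp add: root)
    show "(\<Sum>k<n. ([:0, 1:] ^ i) ^ k) \<in> M" if "0 < i" "i < n" for i
      by (intro subsetD[OF M(2)] kernel) (simp add: geo that)
  qed
qed

subsection \<open>Arithmetic modulo a maximal ideal\<close>

context maximal_ideal
begin

definition cong (infix "\<simeq>" 50) where "a \<simeq> b \<longleftrightarrow> a - b \<in> M"

lemma cong_0_iff: "a \<simeq> 0 \<longleftrightarrow> a \<in> M" by (simp add: cong_def)

lemma cong_refl [simp, intro]: "a \<simeq> a" by (simp add: cong_def zero_mem)

lemma cong_sym: "a \<simeq> b \<Longrightarrow> b \<simeq> a"
  using mult_mem[of "a - b" "-1"] by (simp add: cong_def)

lemma cong_trans [trans]: "a \<simeq> b \<Longrightarrow> b \<simeq> c \<Longrightarrow> a \<simeq> c"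
  using add_mem[of "a - b" "b - c"] by (simp add: cong_def)

lemma cong_add: "a \<simeq> b \<Longrightarrow> c \<simeq> d \<Longrightarrow> a + c \<simeq> b + d"
  using add_mem[of "a - b" "c - d"] by (simp add: cong_def algebra_simps)

lemma cong_minus: "a \<simeq> b \<Longrightarrow> - a \<simeq> - b"
  using mult_mem[of "a - b" "-1"] by (simp add: cong_def)

lemma cong_diff: "a \<simeq> b \<Longrightarrow> c \<simeq> d \<Longrightarrow> a - c \<simeq> b - d"
  using cong_add[of a b "- c" "- d"] cong_minus by simp

lemma cong_mult: "a \<simeq> b \<Longrightarrow> c \<simeq> d \<Longrightarrow> a * c \<simeq> b * d"
  using add_mem[OF mult_mem[of "a - b" c] mult_mem[of "c - d" b]]
  by (simp add: cong_def algebra_simps)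

lemma cong_power: "a \<simeq> b \<Longrightarrow> a ^ k \<simeq> b ^ k"
  by (induction k) (auto intro: cong_mult)

lemma cong_sum: "(\<And>i. i \<in> A \<Longrightarrow> f i \<simeq> g i) \<Longrightarrow> sum f A \<simeq> sum g A"
  by (induction A rule: infinite_finite_induct) (auto intro: cong_add)

lemma cong_diff_iff: "a - b \<simeq> 0 \<longleftrightarrow> a \<simeq> b" by (simp add: cong_def)

lemma cong_mult_0: "a * b \<simeq> 0 \<Longrightarrow> a \<simeq> 0 \<or> b \<simeq> 0"
proof (rule disjCI)
  assume ab: "a * b \<simeq> 0" and "\<not> b \<simeq> 0"
  then obtain c where "b * c - 1 \<in> M" using inverse_mem by (auto simp: cong_0_iff)
  then have "1 \<simeq> b * c" by (intro cong_sym[of "b * c"]) (simp add: cong_def)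
  then have "a * 1 \<simeq> a * (b * c)" by (intro cong_mult cong_refl)
  also have "a * (b * c) = (a * b) * c" by (simp add: mult.assoc)
  also have "(a * b) * c \<simeq> 0 * c" using ab by (rule cong_mult) simp
  finally show "a \<simeq> 0" by simp
qed

lemma one_not_cong_0: "\<not> 1 \<simeq> 0" using one_not_mem by (simp add: cong_0_iff)

lemma cong_power_0: "a ^ k \<simeq> 0 \<Longrightarrow> a \<simeq> 0"
  by (induction k) (use one_not_cong_0 cong_mult_0 in auto)

lemma cong_prod_0: "finite A \<Longrightarrow> prod f A \<simeq> 0 \<Longrightarrow> \<exists>i\<in>A. f i \<simeq> 0"
  by (induction A rule: finite_induct) (use one_not_cong_0 cong_mult_0 in auto)

section \<open>Roots of polynomials and interpolation over the residue field\<close>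

definition incong_on :: "('b \<Rightarrow> 'a) \<Rightarrow> 'b set \<Rightarrow> bool" where
  "incong_on f A \<longleftrightarrow> (\<forall>i\<in>A. \<forall>j\<in>A. f i \<simeq> f j \<longrightarrow> i = j)"

lemma incong_onD: "incong_on f A \<Longrightarrow> f i \<simeq> f j \<Longrightarrow> i \<in> A \<Longrightarrow> j \<in> A \<Longrightarrow> i = j"
  by (auto simp: incong_on_def)

lemma incong_on_subset: "incong_on f A \<Longrightarrow> B \<subseteq> A \<Longrightarrow> incong_on f B"
  by (auto simp: incong_on_def)

text \<open>Linear factors are split off one at a time. The quotient keeps the leading coefficient,
  which must lie outside \<open>M\<close> for the degree to survive reduction modulo
  \<open>M\<close>.\<close>

lemma card_cong_roots_le_degree:
  assumes "\<not> lead_coeff f \<simeq> 0" "finite A" "incong_on \<alpha> A" "\<And>i. i \<in> A \<Longrightarrow> poly f (\<alpha> i) \<simeq> 0"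
  shows "card A \<le> degree f"
  using assms
proof (induction "degree f" arbitrary: f A)
  case 0
  then obtain a where "f = [:a:]" by (metis degree_eq_zeroE)
  with 0 have "A = {}" by auto
  then show ?case by simp
next
  case (Suc d)
  show ?case
  proof (cases "A = {}")
    case False
    then obtain i where i: "i \<in> A" by blast
    define g where "g = synthetic_div f (\<alpha> i)"
    have f: "f = [:- \<alpha> i, 1:] * g + [:poly f (\<alpha> i):]"
      unfolding g_def by (rule synthetic_div_correct'[symmetric])
    have deg: "degree g = d" using Suc.hyps(2) unfolding g_def degree_synthetic_div by simp
    have "coeff f (Suc d) = coeff g d - \<alpha> i * coeff g (Suc d)"
      by (subst f) (simp add: algebra_simps)
    then have "coeff f (Suc d) = coeff g d" using deg by (simp add: coeff_eq_0)
    then have lead: "lead_coeff g = lead_coeff f" using Suc.hyps(2) deg by simp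
    have "card (A - {i}) \<le> degree g"
    proof (rule Suc.hyps(1))
      show "d = degree g" using deg by simp
      show "\<not> lead_coeff g \<simeq> 0" using Suc.prems(1) lead by simp
      show "finite (A - {i})" "incong_on \<alpha> (A - {i})" using Suc.prems by (auto intro: incong_on_subset)
      fix j assume j: "j \<in> A - {i}"
      have "(\<alpha> j - \<alpha> i) * poly g (\<alpha> j) = poly f (\<alpha> j) - poly f (\<alpha> i)"
        by (subst (1) f) (simp add: algebra_simps)
      also have "\<dots> \<simeq> 0 - 0" using Suc.prems(4) i j by (intro cong_diff) auto
      finally have "\<alpha> j - \<alpha> i \<simeq> 0 \<or> poly g (\<alpha> j) \<simeq> 0" by (intro cong_mult_0) simp
      moreover have "\<not> \<alpha> j \<simeq> \<alpha> i" using incong_onD[OF Suc.prems(3)] i j by auto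
      ultimately show "poly g (\<alpha> j) \<simeq> 0" by (simp add: cong_diff_iff)
    qed
    then show ?thesis using deg Suc.hyps(2) i Suc.prems(2) by simp
  qed simp
qed

lemma card_cong_roots_le:
  assumes "degree f \<le> d" "coeff f d = 1"
    and "finite A" "incong_on \<alpha> A" "\<And>i. i \<in> A \<Longrightarrow> poly f (\<alpha> i) \<simeq> 0"
  shows "card A \<le> d"
proof -
  have "degree f = d" using assms(1,2) le_degree[of f d] one_not_cong_0 by fastforce
  then show ?thesis
    using card_cong_roots_le_degree[of f A \<alpha>] assms one_not_cong_0 by simp
qed

text \<open>Newton's scheme: the interpolant for \<open>A\<close> is corrected at the new node by a
  multiple of \<open>h\<close>, which vanishes on the old nodes and is invertible modulo
  \<open>M\<close> at the new one.\<close>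

lemma interpolation:
  assumes "finite A" "incong_on \<alpha> A"
  shows "\<exists>f. degree f \<le> card A - 1 \<and> (\<forall>i\<in>A. poly f (\<alpha> i) \<simeq> s i)"
  using assms
proof (induction A rule: finite_induct)
  case empty
  show ?case by (rule exI[of _ 0]) simp
next
  case (insert i A)
  then obtain f where f: "degree f \<le> card A - 1" "\<And>j. j \<in> A \<Longrightarrow> poly f (\<alpha> j) \<simeq> s j"
    using incong_on_subset[of \<alpha> "insert i A" A] by auto
  define h where "h = (\<Prod>j\<in>A. [:- \<alpha> j, 1:])"
  have "degree h \<le> sum (degree \<circ> (\<lambda>j. [:- \<alpha> j, 1:])) A"
    unfolding h_def using insert by (intro degree_prod_sum_le)
  then have degh: "degree h \<le> card A" by simp
  have ph: "poly h x = (\<Prod>j\<in>A. x - \<alpha> j)" for x by (simp add: h_def poly_prod)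
  have "\<not> poly h (\<alpha> i) \<simeq> 0"
  proof
    assume "poly h (\<alpha> i) \<simeq> 0"
    then obtain j where "j \<in> A" "\<alpha> i \<simeq> \<alpha> j"
      using cong_prod_0[OF insert(1), of "\<lambda>j. \<alpha> i - \<alpha> j"] unfolding ph by (auto simp: cong_diff_iff)
    then show False using insert incong_onD[of \<alpha> "insert i A" i j] by auto
  qed
  then obtain b where b: "poly h (\<alpha> i) * b \<simeq> 1" using inverse_mem by (auto simp: cong_0_iff cong_def)
  define g where "g = f + smult (b * (s i - poly f (\<alpha> i))) h"
  have "degree g \<le> card A"
    unfolding g_def using f(1) degh by (intro degree_add_le order.trans[OF degree_smult_le]) auto
  moreover have "poly g (\<alpha> i) \<simeq> s i"
  proof -
    have "poly g (\<alpha> i) = poly f (\<alpha> i) + (poly h (\<alpha> i) * b) * (s i - poly f (\<alpha> i))"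
      by (simp add: g_def algebra_simps)
    also have "\<dots> \<simeq> poly f (\<alpha> i) + 1 * (s i - poly f (\<alpha> i))" using b by (intro cong_add cong_mult cong_refl)
    finally show ?thesis by simp
  qed
  moreover have "poly g (\<alpha> j) \<simeq> s j" if "j \<in> A" for j
  proof -
    have "poly h (\<alpha> j) = 0" unfolding ph using insert that by (intro prod_zero) auto
    then show ?thesis using f(2)[OF that] by (simp add: g_def)
  qed
  ultimately show ?case using insert by (intro exI[of _ g]) auto
qed

text \<open>For \<open>x\<close> congruent to 1 the sum would be congruent to \<open>n\<close>, so
  \<open>n\<close> and \<open>Suc n\<close> would both lie in \<open>M\<close>. Applied to powers of
  \<open>z\<close>, this shows that the order of \<open>z\<close> is exactly
  \<open>n\<close>.\<close>

lemma not_cong_1_if_sum_powers: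
  assumes "(\<Sum>k<n. x ^ k) \<in> M" "of_nat (Suc n) \<in> M"
  shows "x - 1 \<notin> M"
proof
  assume "x - 1 \<in> M"
  then have "(\<Sum>k<n. x ^ k) \<simeq> (\<Sum>k<n. 1 ^ k)"
    by (intro cong_sum cong_power) (simp add: cong_def)
  then have "of_nat n \<simeq> (\<Sum>k<n. x ^ k)" by (simp add: cong_sym)
  also have "\<dots> \<simeq> 0" using assms(1) by (simp add: cong_0_iff)
  finally have "of_nat (Suc n) - of_nat n \<simeq> 0 - 0"
    using assms(2) by (intro cong_diff) (simp_all only: cong_0_iff)
  then show False using one_not_cong_0 by simp
qed

section \<open>The Frobenius map modulo the ideal\<close>

lemma frobenius_add:
  assumes p: "prime (p :: nat)" "of_nat p \<in> M"
  shows "(x + y) ^ p \<simeq> x ^ p + y ^ p"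
proof -
  have "p > 0" using p(1) prime_gt_0_nat by blast
  have "(x + y) ^ p = (\<Sum>k\<le>p. of_nat (p choose k) * x ^ k * y ^ (p - k))"
    by (rule binomial_ring)
  also have "\<dots> \<simeq> (\<Sum>k\<le>p. (if k = 0 then y ^ p else 0) + (if k = p then x ^ p else 0))"
  proof (rule cong_sum)
    fix k assume k: "k \<in> {..p}"
    show "of_nat (p choose k) * x ^ k * y ^ (p - k) \<simeq> (if k = 0 then y ^ p else 0) + (if k = p then x ^ p else 0)"
    proof (cases "k = 0 \<or> k = p")
      case True
      then show ?thesis using \<open>p > 0\<close> by auto
    next
      case False
      with k have "p dvd (p choose k)" using p by (intro dvd_choose_prime) (auto simp: prime_gt_0_nat)
      then obtain l where "p choose k = l * p" by (auto simp: dvd_def mult.commute)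
      then have "of_nat (p choose k) * x ^ k * y ^ (p - k) = (of_nat l * x ^ k * y ^ (p - k)) * of_nat p"
        by (simp add: algebra_simps)
      also have "\<dots> \<in> M" using p(2) by (rule mult_mem)
      finally show ?thesis using False by (simp add: cong_0_iff)
    qed
  qed
  also have "\<dots> = x ^ p + y ^ p" using \<open>p > 0\<close> by (simp add: sum.distrib)
  finally show ?thesis .
qed

lemma frobenius_power_add:
  assumes "prime (p :: nat)" "of_nat p \<in> M"
  shows "(x + y) ^ (p ^ k) \<simeq> x ^ (p ^ k) + y ^ (p ^ k)"
proof (induction k)
  case (Suc k)
  have "(x + y) ^ (p ^ Suc k) = ((x + y) ^ (p ^ k)) ^ p"
    by (simp add: power_mult[symmetric] mult.commute)
  also have "\<dots> \<simeq> (x ^ (p ^ k) + y ^ (p ^ k)) ^ p" using Suc by (rule cong_power)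
  also have "\<dots> \<simeq> (x ^ (p ^ k)) ^ p + (y ^ (p ^ k)) ^ p" using assms by (rule frobenius_add)
  also have "\<dots> = x ^ (p ^ Suc k) + y ^ (p ^ Suc k)"
    by (simp add: power_mult[symmetric] mult.commute)
  finally show ?case .
qed auto

lemma frobenius_power_sum:
  assumes "prime (p :: nat)" "of_nat p \<in> M"
  shows "(\<Sum>i\<in>A. f i) ^ (p ^ k) \<simeq> (\<Sum>i\<in>A. f i ^ (p ^ k))"
proof (induction A rule: infinite_finite_induct)
  case (insert i A)
  have "(\<Sum>i\<in>insert i A. f i) ^ (p ^ k) = (f i + (\<Sum>i\<in>A. f i)) ^ (p ^ k)" using insert by simp
  also have "\<dots> \<simeq> f i ^ (p ^ k) + (\<Sum>i\<in>A. f i) ^ (p ^ k)" using assms by (rule frobenius_power_add)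
  also have "\<dots> \<simeq> f i ^ (p ^ k) + (\<Sum>i\<in>A. f i ^ (p ^ k))" using insert by (intro cong_add) auto
  finally show ?case using insert by simp
qed (use assms prime_gt_0_nat in \<open>auto simp: zero_power\<close>)

end

text \<open>Modulo \<open>M\<close> the map taking \<open>f\<close> to \<open>f ^ (p ^ k)\<close> is
  a ring homomorphism. It fixes the integers and the indeterminate, hence every integer
  polynomial.\<close>

lemma int_poly_power_cong:
  fixes M :: "int poly set"
  assumes "maximal_ideal M" "prime p" "of_nat p \<in> M" "[:0, 1:] ^ (p ^ k) - [:0, 1:] \<in> M"
  shows "f ^ (p ^ k) - f \<in> M"
proof -
  interpret maximal_ideal M by fact
  note add = frobenius_power_add[OF assms(2,3), where k = k]
  have pk: "p ^ k > 0" using assms(2) prime_gt_0_nat by simp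
  have nat: "of_nat a ^ (p ^ k) \<simeq> of_nat a" for a
  proof (induction a)
    case (Suc a)
    have "(1 + of_nat a) ^ (p ^ k) \<simeq> 1 ^ (p ^ k) + of_nat a ^ (p ^ k)" by (rule add)
    also have "\<dots> \<simeq> 1 + of_nat a" using Suc by (intro cong_add) auto
    finally show ?case by simp
  qed (use pk in \<open>simp add: zero_power\<close>)
  \<comment> \<open>Additivity at \<open>x + - x\<close> gives the sign for odd \<open>p\<close> and
    for \<open>p = 2\<close> alike.\<close>
  have neg: "(- x) ^ (p ^ k) \<simeq> - (x ^ (p ^ k))" for x
  proof -
    have "(x + - x) ^ (p ^ k) \<simeq> x ^ (p ^ k) + (- x) ^ (p ^ k)" by (rule add)
    then have "x ^ (p ^ k) + (- x) ^ (p ^ k) \<simeq> 0" using pk cong_sym by (simp add: zero_power)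
    then have "x ^ (p ^ k) + (- x) ^ (p ^ k) - x ^ (p ^ k) \<simeq> 0 - x ^ (p ^ k)" by (intro cong_diff) auto
    then show ?thesis by simp
  qed
  have const: "[:a:] ^ (p ^ k) \<simeq> [:a:]" for a :: int
  proof (cases a)
    case (nonneg b)
    then have "[:a:] = of_nat b" by (simp add: of_nat_poly)
    then show ?thesis using nat by simp
  next
    case (neg b)
    then have a: "[:a:] = - of_nat (Suc b)" by (simp add: of_nat_poly)
    have "(- of_nat (Suc b)) ^ (p ^ k) \<simeq> - (of_nat (Suc b) ^ (p ^ k) :: int poly)" by fact
    also have "\<dots> \<simeq> - of_nat (Suc b)" using nat by (rule cong_minus)
    finally show ?thesis unfolding a .
  qed
  have "f ^ (p ^ k) \<simeq> f"
  proof (induction f)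
    case (pCons a f)
    have eq: "pCons a f = [:a:] + [:0, 1:] * f" by simp
    have "pCons a f ^ (p ^ k) \<simeq> [:a:] ^ (p ^ k) + ([:0, 1:] * f) ^ (p ^ k)"
      unfolding eq by (rule add)
    also have "\<dots> = [:a:] ^ (p ^ k) + [:0, 1:] ^ (p ^ k) * f ^ (p ^ k)" by (simp only: power_mult_distrib)
    also have "\<dots> \<simeq> [:a:] + [:0, 1:] * f"
      using const pCons assms(4) by (intro cong_add cong_mult) (auto simp: cong_def)
    finally show ?case unfolding eq .
  qed (use pk in \<open>simp add: zero_power\<close>)
  then show ?thesis by (simp add: cong_def)
qed

subsection \<open>The finite field, its subfield and the trace\<close>

text \<open>An interface to the field of order \<open>q ^ m\<close>: \<open>z_primitive\<close>
  provides \<open>n\<close> distinct nonzero classes, and \<open>power_qm\<close> leaves room for no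
  further class but zero.\<close>

locale cyclotomic_quotient = maximal_ideal M
  for M :: "'a::comm_ring_1 set" +
  fixes p r m q n :: nat and z :: 'a
  assumes prime_p: "prime p" and q_def: "q = p ^ r" and q_gt: "1 < q" and m_gt: "1 < m"
    and n_def: "n = q ^ m - 1"
    and p_mem: "of_nat p \<in> M"
    and z_n: "z ^ n - 1 \<in> M"
    and z_primitive: "0 < i \<Longrightarrow> i < n \<Longrightarrow> z ^ i - 1 \<notin> M"
    and power_qm: "x ^ (q ^ m) - x \<in> M"
begin

lemma q_m: "q ^ m = Suc n" using q_gt by (simp add: n_def)

lemma n_gt: "n > 0"
  using q_m one_less_power[of q m] q_gt m_gt by simp

lemma z_n_cong: "z ^ n \<simeq> 1" using z_n by (simp add: cong_def)

lemma power_qm_cong: "x ^ (q ^ m) \<simeq> x" using power_qm by (simp add: cong_def)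

lemma z_not_0: "\<not> z ^ i \<simeq> 0"
proof
  assume "z ^ i \<simeq> 0"
  then have "z ^ n \<simeq> 0 ^ n" by (intro cong_power cong_power_0[of z i])
  then have "z ^ n \<simeq> 0" using n_gt by (simp add: zero_power)
  then have "1 \<simeq> 0" using cong_trans[OF cong_sym[OF z_n_cong]] by simp
  then show False using one_not_cong_0 by simp
qed

lemma power_q_add: "(x + y) ^ (q ^ l) \<simeq> x ^ (q ^ l) + y ^ (q ^ l)"
  using frobenius_power_add[OF prime_p p_mem, of x y "r * l"] by (simp add: q_def power_mult)

lemma power_q_sum: "(\<Sum>i\<in>A. f i) ^ (q ^ l) \<simeq> (\<Sum>i\<in>A. f i ^ (q ^ l))"
  using frobenius_power_sum[OF prime_p p_mem, of f A "r * l"] by (simp add: q_def power_mult)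

lemma incong_z: "incong_on (\<lambda>i. z ^ i) {..<n}"
proof -
  have False if ij: "i < j" "j < n" "z ^ i \<simeq> z ^ j" for i j
  proof -
    have "z ^ i * (1 - z ^ (j - i)) = z ^ i - z ^ j"
      using ij by (simp add: algebra_simps flip: power_add)
    also have "\<dots> \<simeq> 0" using ij by (simp add: cong_diff_iff)
    finally have "1 \<simeq> z ^ (j - i)" using cong_mult_0 z_not_0 cong_diff_iff by blast
    then show False using z_primitive[of "j - i"] ij cong_sym[of 1] by (simp add: cong_def less_imp_diff_less)
  qed
  then show ?thesis unfolding incong_on_def by (metis cong_sym lessThan_iff linorder_neqE_nat)
qed

text \<open>\<open>el\<close> on \<open>{..n}\<close> is a system of representatives modulo \<open>M\<close>; the index \<open>n\<close> stands for zero.\<close>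

definition el :: "nat \<Rightarrow> 'a" where "el j = (if j < n then z ^ j else 0)"

lemma incong_el: "incong_on el {..n}"
proof -
  have "i = j" if ij: "i \<le> n" "j \<le> n" "el i \<simeq> el j" for i j
  proof (cases "i < n"; cases "j < n")
    assume "i < n" "j < n"
    then show ?thesis using ij incong_onD[OF incong_z] by (simp add: el_def)
  next
    assume "\<not> i < n" "j < n"
    then show ?thesis using ij z_not_0[of j] cong_sym[of 0 "z ^ j"] by (simp add: el_def)
  next
    assume "i < n" "\<not> j < n"
    then show ?thesis using ij z_not_0 by (simp add: el_def)
  qed (use ij in simp)
  then show ?thesis by (simp add: incong_on_def)
qed

text \<open>A further class would be one root too many: \<open>\<alpha>\<close> would list
  \<open>n + 2\<close> incongruent roots of a monic polynomial of degree
  \<open>n + 1\<close>.\<close>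

lemma ex_el: "\<exists>j\<le>n. x \<simeq> el j"
proof (rule ccontr)
  assume not: "\<not> (\<exists>j\<le>n. x \<simeq> el j)"
  define \<alpha> where "\<alpha> = el(Suc n := x)"
  define f :: "'a poly" where "f = monom 1 (Suc n) - [:0, 1:]"
  have "degree f \<le> Suc n" unfolding f_def
    by (intro degree_diff_le) (auto intro: degree_monom_le)
  moreover have "coeff f (Suc n) = 1" using n_gt by (cases n) (simp_all add: f_def)
  moreover have "incong_on \<alpha> {..Suc n}"
  proof -
    have "\<not> x \<simeq> el j" "\<not> el j \<simeq> x" if "j \<le> n" for j
      using not that cong_sym[of "el j" x] by blast+
    then show ?thesis
      using incong_onD[OF incong_el] by (auto simp: incong_on_def \<alpha>_def le_Suc_eq)
  qed
  moreover have "poly f (\<alpha> i) \<simeq> 0" for i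
    using power_qm[of "\<alpha> i"] by (simp add: f_def poly_monom q_m cong_0_iff)
  ultimately have "card {..Suc n} \<le> Suc n" by (intro card_cong_roots_le[of f _ _ \<alpha>]) auto
  then show False by simp
qed

definition rep :: "'a \<Rightarrow> nat" where "rep x = (SOME j. j \<le> n \<and> x \<simeq> el j)"

lemma rep: "rep x \<le> n" "x \<simeq> el (rep x)"
  using someI_ex[OF ex_el[of x]] by (auto simp: rep_def)

lemma el_rep: "el (rep x) \<simeq> x"
  using rep(2) by (rule cong_sym)

lemma rep_eqD: "rep x = rep y \<Longrightarrow> x \<simeq> y"
  using rep(2) cong_sym cong_trans by metis

lemma rep_cong: "x \<simeq> y \<Longrightarrow> rep x = rep y"
  by (rule incong_onD[OF incong_el])
    (use rep(1) cong_trans[OF cong_trans[OF el_rep, of x y] rep(2)] in auto)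

text \<open>The subfield of order \<open>q\<close>, as a union of residue classes.\<close>

definition base :: "'a set" where "base = {x. x ^ q \<simeq> x}"

lemma base_add: assumes "x \<in> base" "y \<in> base" shows "x + y \<in> base"
proof -
  have "(x + y) ^ q \<simeq> x ^ q + y ^ q" using power_q_add[of x y 1] by simp
  also have "\<dots> \<simeq> x + y" using assms by (intro cong_add) (auto simp: base_def)
  finally show ?thesis by (simp add: base_def)
qed

lemma base_diff: assumes "x \<in> base" "y \<in> base" shows "x - y \<in> base"
proof -
  have "(x - y) ^ q + y ^ q \<simeq> ((x - y) + y) ^ q"
    using power_q_add[of "x - y" y 1] cong_sym by simp
  then have "(x - y) ^ q + y ^ q - y ^ q \<simeq> x ^ q - y ^ q" by (intro cong_diff) auto
  also have "\<dots> \<simeq> x - y" using assms by (intro cong_diff) (auto simp: base_def)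
  finally show ?thesis by (simp add: base_def)
qed

text \<open>The trace to the subfield of order \<open>q\<close>, as the sum of the
  conjugates.\<close>

definition tr :: "'a \<Rightarrow> 'a" where "tr x = (\<Sum>l<m. x ^ (q ^ l))"

lemma tr_cong: "x \<simeq> y \<Longrightarrow> tr x \<simeq> tr y"
  unfolding tr_def by (intro cong_sum cong_power)

lemma tr_add: "tr (x + y) \<simeq> tr x + tr y"
  unfolding tr_def sum.distrib[symmetric] by (intro cong_sum power_q_add)

text \<open>Raising to the power \<open>q\<close> permutes the summands cyclically, since
  \<open>x ^ (q ^ m)\<close> is congruent to \<open>x\<close>.\<close>

lemma tr_base: "tr x \<in> base"
proof -
  obtain k where k: "m = Suc k" using m_gt by (cases m) auto
  have "tr x ^ q \<simeq> (\<Sum>l<m. (x ^ (q ^ l)) ^ q)"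
    using power_q_sum[of "\<lambda>l. x ^ (q ^ l)" "{..<m}" 1] by (simp add: tr_def)
  also have "\<dots> = (\<Sum>l<k. x ^ (q ^ Suc l)) + x ^ (q ^ m)"
    by (simp add: k mult.commute flip: power_mult)
  also have "\<dots> \<simeq> (\<Sum>l<k. x ^ (q ^ Suc l)) + x" by (intro cong_add power_qm_cong cong_refl)
  also have "\<dots> = (\<Sum>l<Suc k. x ^ (q ^ l))" unfolding sum.lessThan_Suc_shift by simp
  also have "\<dots> = tr x" unfolding tr_def by (simp only: k)
  finally show ?thesis by (simp add: base_def)
qed

definition base_ix :: "nat set" where "base_ix = {j. j \<le> n \<and> el j \<in> base}"

lemma card_base_ix_le: "card base_ix \<le> q"
proof -
  define f :: "'a poly" where "f = monom 1 q - [:0, 1:]"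
  have "degree f \<le> q" unfolding f_def using q_gt
    by (intro degree_diff_le) (auto intro: degree_monom_le)
  moreover have "coeff f q = 1" using q_gt by (cases q) (auto simp: f_def coeff_pCons split: nat.split)
  moreover have "incong_on el base_ix"
    using incong_el by (rule incong_on_subset) (auto simp: base_ix_def)
  moreover have "poly f (el i) \<simeq> 0" if "i \<in> base_ix" for i
    using that by (simp add: f_def poly_monom base_ix_def base_def cong_diff_iff)
  ultimately show ?thesis by (intro card_cong_roots_le[of f _ _ el]) (auto simp: base_ix_def)
qed

text \<open>The fibre consists of roots of the trace polynomial minus \<open>y\<close>. Since
  \<open>q > 1\<close>, its exponents are distinct and positive, so the coefficient at
  \<open>q ^ (m - 1)\<close> is 1.\<close>

lemma card_tr_fibre_le: "card {j. j \<le> n \<and> tr (el j) \<simeq> y} \<le> q ^ (m - 1)"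
proof -
  define f where "f = (\<Sum>l<m. monom 1 (q ^ l)) - [:y:]"
  have "q ^ l \<le> q ^ (m - 1)" if "l < m" for l
    using that q_gt by (intro power_increasing) auto
  then have "degree f \<le> q ^ (m - 1)"
    unfolding f_def by (intro degree_diff_le degree_sum_le) (auto intro: order.trans[OF degree_monom_le])
  moreover have "coeff f (q ^ (m - 1)) = 1"
  proof -
    have "coeff [:y:] (q ^ (m - 1)) = 0" using q_gt by (intro coeff_eq_0) simp
    then have "coeff f (q ^ (m - 1)) = (\<Sum>l<m. if l = m - 1 then 1 else 0)"
      using q_gt by (simp add: f_def coeff_sum)
    then show ?thesis using m_gt by simp
  qed
  moreover have "poly f (el j) \<simeq> 0" if "tr (el j) \<simeq> y" for j
    using that by (simp add: f_def poly_sum poly_monom tr_def cong_diff_iff)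
  ultimately show ?thesis
    by (intro card_cong_roots_le[of f _ _ el] incong_on_subset[OF incong_el]) auto
qed

text \<open>The fibres of the trace have at most \<open>q ^ (m - 1)\<close> classes, hence its image at least \<open>q\<close>, while
  the subfield has at most \<open>q\<close>: this gives at once its order and the surjectivity of the trace.\<close>

lemma rep_tr_image: "(\<lambda>j. rep (tr (el j))) ` {..n} = base_ix" and card_base_ix: "card base_ix = q"
proof -
  let ?t = "\<lambda>j. rep (tr (el j))"
  have sub: "?t ` {..n} \<subseteq> base_ix"
  proof (rule image_subsetI)
    fix j
    have "el (?t j) ^ q \<simeq> tr (el j) ^ q" by (intro cong_power el_rep)
    also have "\<dots> \<simeq> tr (el j)" using tr_base by (simp add: base_def)
    also have "\<dots> \<simeq> el (?t j)" by (rule rep)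
    finally show "?t j \<in> base_ix" using rep(1) by (simp add: base_ix_def base_def)
  qed
  have fin: "finite base_ix" by (simp add: base_ix_def)
  \<comment> \<open>All residue classes are counted according to their trace.\<close>
  have "q ^ m = card {..n}" by (simp add: q_m)
  also have "\<dots> = (\<Sum>g\<in>?t ` {..n}. card {j \<in> {..n}. ?t j = g})"
    using sum.group[of "{..n}" "?t ` {..n}" ?t "\<lambda>_. 1::nat"] by simp
  also have "\<dots> \<le> (\<Sum>g\<in>?t ` {..n}. q ^ (m - 1))"
  proof (rule sum_mono)
    fix g
    have "card {j \<in> {..n}. ?t j = g} \<le> card {j. j \<le> n \<and> tr (el j) \<simeq> el g}"
      using rep(2) by (intro card_mono) auto
    also have "\<dots> \<le> q ^ (m - 1)" by (rule card_tr_fibre_le)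
    finally show "card {j \<in> {..n}. ?t j = g} \<le> q ^ (m - 1)" .
  qed
  finally have "q ^ m \<le> card (?t ` {..n}) * q ^ (m - 1)" by simp
  moreover have "q ^ m = q * q ^ (m - 1)" using m_gt by (cases m) auto
  ultimately have "q \<le> card (?t ` {..n})" using q_gt by simp
  moreover have "card (?t ` {..n}) \<le> card base_ix" using sub fin by (rule card_mono[rotated])
  ultimately show "?t ` {..n} = base_ix" "card base_ix = q"
    using card_base_ix_le card_subset_eq[OF fin sub] by auto
qed

lemma tr_surj: assumes "x \<in> base" shows "\<exists>y. tr y \<simeq> x"
proof -
  have "el (rep x) ^ q \<simeq> x ^ q" by (intro cong_power el_rep)
  also have "\<dots> \<simeq> x" using assms by (simp add: base_def)
  also have "\<dots> \<simeq> el (rep x)" by (rule rep)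
  finally have "rep x \<in> base_ix" using rep(1) by (simp add: base_ix_def base_def)
  then obtain j where "rep x = rep (tr (el j))" unfolding rep_tr_image[symmetric] by blast
  then show ?thesis using rep_eqD by metis
qed

text \<open>An arbitrary bijection from the alphabet \<open>{..<q}\<close> to representatives of the
  subfield; it lets words be added although their letters are plain numbers.\<close>

definition letter :: "nat \<Rightarrow> 'a" where
  "letter = (\<lambda>a. el ((SOME h. bij_betw h {..<q} base_ix) a))"

lemma letter_base: "a < q \<Longrightarrow> letter a \<in> base"
  and incong_letter: "incong_on letter {..<q}"
  and ex_letter: "x \<in> base \<Longrightarrow> \<exists>a. a < q \<and> letter a \<simeq> x"
proof -
  define h where "h = (SOME h. bij_betw h {..<q} base_ix)"
  have "\<exists>h. bij_betw h {..<q} base_ix"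
    using finite_same_card_bij[of "{..<q}" base_ix] card_base_ix by (simp add: base_ix_def)
  then have h: "bij_betw h {..<q} base_ix" unfolding h_def by (rule someI_ex)
  have mem: "h a \<in> base_ix" if "a < q" for a using h that by (auto simp: bij_betw_def)
  have letter: "letter a = el (h a)" for a by (simp add: letter_def h_def)
  show "a < q \<Longrightarrow> letter a \<in> base" using mem by (auto simp: letter base_ix_def)
  show "incong_on letter {..<q}"
    using incong_el mem h
    by (auto simp: incong_on_def letter base_ix_def bij_betw_def inj_on_def)
  show "\<exists>a. a < q \<and> letter a \<simeq> x" if x: "x \<in> base"
  proof -
    have "el (rep x) ^ q \<simeq> x ^ q" by (intro cong_power el_rep)
    also have "\<dots> \<simeq> x" using x by (simp add: base_def)
    also have "\<dots> \<simeq> el (rep x)" by (rule rep)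
    finally have "rep x \<in> base_ix" using rep(1) by (simp add: base_ix_def base_def)
    then obtain a where "a < q" "rep x = h a" using h by (auto simp: bij_betw_def)
    then show ?thesis using rep(2)[of x] cong_sym by (auto simp: letter)
  qed
qed

definition digit :: "'a \<Rightarrow> nat" where "digit x = (SOME a. a < q \<and> letter a \<simeq> x)"

lemma digit: assumes "x \<in> base" shows "digit x < q" "letter (digit x) \<simeq> x"
  using someI_ex[OF ex_letter[OF assms]] by (auto simp: digit_def)

lemma digit_cong: assumes "x \<simeq> y" shows "digit x = digit y"
proof -
  have "letter a \<simeq> x \<longleftrightarrow> letter a \<simeq> y" for a using assms cong_sym cong_trans by blast
  then show ?thesis by (simp add: digit_def)
qed

text \<open>The geometric sum times \<open>z ^ e - 1\<close>, which is nonzero modulo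
  \<open>M\<close>, is congruent to 0. This is the orthogonality behind the duality of the two BCH
  codes.\<close>

lemma sum_z_powers: assumes "0 < e" "e < n" shows "(\<Sum>i<n. z ^ (i * e)) \<simeq> 0"
proof -
  have "(z ^ e - 1) * (\<Sum>i<n. z ^ (i * e)) = (z ^ n) ^ e - 1"
    using power_diff_1_eq[of "z ^ e" n] by (simp add: mult.commute flip: power_mult)
  also have "\<dots> \<simeq> 1 ^ e - 1" by (intro cong_diff cong_power z_n_cong cong_refl)
  finally have "z ^ e - 1 \<simeq> 0 \<or> (\<Sum>i<n. z ^ (i * e)) \<simeq> 0" by (intro cong_mult_0) simp
  then show ?thesis using z_primitive[OF assms] by (auto simp: cong_0_iff)
qed

end

subsection \<open>The code\<close>

context cyclotomic_quotient
begin

lemma words_eqI: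
  assumes "x \<in> words q n" "y \<in> words q n" "\<And>i. i < n \<Longrightarrow> letter (x i) \<simeq> letter (y i)"
  shows "x = y"
proof
  fix i
  show "x i = y i"
  proof (cases "i < n")
    case True
    then show ?thesis using assms by (intro incong_onD[OF incong_letter]) (auto simp: words_def)
  next
    case False
    then show ?thesis using assms(1,2) by (simp add: words_def PiE_iff extensional_def)
  qed
qed

lemma letter_word_base: "x \<in> words q n \<Longrightarrow> i < n \<Longrightarrow> letter (x i) \<in> base"
  by (intro letter_base) (auto simp: words_def)

text \<open>Adds to \<open>x\<close> the word of traces of the values of \<open>f\<close>, so the
  additive group of polynomials acts on the words.\<close>

definition shift :: "'a poly \<Rightarrow> (nat \<Rightarrow> nat) \<Rightarrow> nat \<Rightarrow> nat" where
  "shift f x = (\<lambda>i\<in>{..<n}. digit (letter (x i) + tr (poly f (z ^ i))))"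

lemma shift_words: "x \<in> words q n \<Longrightarrow> shift f x \<in> words q n"
  by (auto simp: shift_def words_def intro!: digit(1) base_add letter_base tr_base)

lemma letter_shift: "x \<in> words q n \<Longrightarrow> i < n \<Longrightarrow> letter (shift f x i) \<simeq> letter (x i) + tr (poly f (z ^ i))"
  using digit(2)[OF base_add[OF letter_word_base tr_base]] by (simp add: shift_def)

lemma shift_shift:
  assumes "x \<in> words q n"
  shows "shift f (shift g x) = shift (f + g) x"
proof (intro words_eqI shift_words assms)
  fix i assume i: "i < n"
  have "letter (shift f (shift g x) i) \<simeq> letter (shift g x i) + tr (poly f (z ^ i))"
    using assms i by (intro letter_shift shift_words)
  also have "\<dots> \<simeq> letter (x i) + tr (poly g (z ^ i)) + tr (poly f (z ^ i))"
    using assms i by (intro cong_add letter_shift) auto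
  also have "\<dots> = letter (x i) + (tr (poly f (z ^ i)) + tr (poly g (z ^ i)))" by simp
  also have "\<dots> \<simeq> letter (x i) + tr (poly f (z ^ i) + poly g (z ^ i))"
    using cong_sym[OF tr_add] by (intro cong_add) auto
  also have "\<dots> = letter (x i) + tr (poly (f + g) (z ^ i))" by simp
  also have "\<dots> \<simeq> letter (shift (f + g) x i)" using assms i by (intro cong_sym[OF letter_shift])
  finally show "letter (shift f (shift g x) i) \<simeq> letter (shift (f + g) x i)" .
qed

lemma tr_0: "tr 0 \<simeq> 0"
proof -
  have "tr 0 \<simeq> tr 0 + tr 0" using tr_add[of 0 0] by simp
  then have "tr 0 - tr 0 \<simeq> tr 0 + tr 0 - tr 0" by (intro cong_diff) auto
  then show ?thesis by (simp add: cong_sym)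
qed

lemma shift_0: "x \<in> words q n \<Longrightarrow> shift 0 x = x"
proof (intro words_eqI shift_words)
  fix i assume x: "x \<in> words q n" and i: "i < n"
  have "letter (shift 0 x i) \<simeq> letter (x i) + tr (poly 0 (z ^ i))" using x i by (rule letter_shift)
  also have "\<dots> \<simeq> letter (x i) + 0" using tr_0 by (intro cong_add) auto
  finally show "letter (shift 0 x i) \<simeq> letter (x i)" by simp
qed

lemma shift_inj: "inj_on (shift f) (words q n)"
proof (rule inj_on_inverseI[where g = "shift (- f)"])
  show "shift (- f) (shift f x) = x" if "x \<in> words q n" for x
    using that by (simp add: shift_shift shift_0)
qed

text \<open>An orbit of this action, that is, a coset of the trace code. Different polynomials may
  give the same word.\<close>

definition block :: "nat \<Rightarrow> (nat \<Rightarrow> nat) \<Rightarrow> (nat \<Rightarrow> nat) set" where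
  "block d x = (\<lambda>f. shift f x) ` {f. degree f \<le> d}"

lemma block_subset: "x \<in> words q n \<Longrightarrow> block d x \<subseteq> words q n"
  by (auto simp: block_def shift_words)

lemma block_self: "x \<in> words q n \<Longrightarrow> x \<in> block d x"
  unfolding block_def using shift_0 by (auto intro!: image_eqI[where x = 0])

lemma shift_block: "x \<in> words q n \<Longrightarrow> y \<in> block d x \<Longrightarrow> degree f \<le> d \<Longrightarrow> shift f y \<in> block d x"
  by (auto simp: block_def shift_shift intro: degree_add_le)

lemma block_eq:
  assumes x: "x \<in> words q n" and y: "y \<in> block d x"
  shows "block d y = block d x"
proof -
  obtain g where g: "degree g \<le> d" "y = shift g x" using y by (auto simp: block_def)
  have yw: "y \<in> words q n" using x y block_subset by blast
  have xy: "x = shift (- g) y" using x g by (simp add: shift_shift shift_0)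
  have "x \<in> block d y" unfolding xy using g by (intro shift_block yw block_self) simp
  show ?thesis
  proof
    show "block d y \<subseteq> block d x"
      using shift_block[OF x y] by (auto simp: block_def[of d y])
    show "block d x \<subseteq> block d y"
      using shift_block[OF yw \<open>x \<in> block d y\<close>] by (auto simp: block_def[of d x])
  qed
qed

lemma blocks_meet:
  "x \<in> words q n \<Longrightarrow> y \<in> words q n \<Longrightarrow> w \<in> block d x \<Longrightarrow> w \<in> block d y \<Longrightarrow> block d x = block d y"
  using block_eq by metis

text \<open>The constant coefficient matters only through its trace, which has \<open>q\<close>
  values; each of the other \<open>d\<close> coefficients matters only through its class, one of
  \<open>q ^ m\<close>. The saving at the constant coefficient is why the code loses
  \<open>1 + m * (2 * c - 3)\<close> dimensions and not \<open>m * (2 * c - 2)\<close>.\<close>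

lemma card_block_le:
  assumes x: "x \<in> words q n"
  shows "card (block d x) \<le> q * (q ^ m) ^ d"
proof -
  define W where "W = (\<lambda>(a, h). \<lambda>i\<in>{..<n}. digit (letter (x i) + (letter a + tr (\<Sum>j=1..d. el (h j) * z ^ (i * j)))))"
  have "block d x \<subseteq> W ` ({..<q} \<times> ({1..d} \<rightarrow>\<^sub>E {..n}))"
  proof
    fix y assume "y \<in> block d x"
    then obtain f where f: "degree f \<le> d" "y = shift f x" by (auto simp: block_def)
    define a where "a = digit (tr (coeff f 0))"
    define h where "h = (\<lambda>j\<in>{1..d}. rep (coeff f j))"
    have "(a, h) \<in> {..<q} \<times> ({1..d} \<rightarrow>\<^sub>E {..n})"
      using digit(1)[OF tr_base] rep(1) by (auto simp: a_def h_def)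
    moreover have "y = W (a, h)"
    proof -
      have "tr (poly f (z ^ i)) \<simeq> letter a + tr (\<Sum>j=1..d. el (h j) * z ^ (i * j))" for i
      proof -
        have "poly f (z ^ i) = (\<Sum>j\<le>d. coeff f j * z ^ (i * j))"
          unfolding poly_altdef power_mult using f(1)
          by (intro sum.mono_neutral_left) (auto simp: coeff_eq_0)
        also have "{..d} = insert 0 {1..d}" by auto
        also have "(\<Sum>j\<in>\<dots>. coeff f j * z ^ (i * j)) = coeff f 0 + (\<Sum>j=1..d. coeff f j * z ^ (i * j))"
          by simp
        finally have "tr (poly f (z ^ i)) \<simeq> tr (coeff f 0) + tr (\<Sum>j=1..d. coeff f j * z ^ (i * j))"
          using tr_add by simp
        also have "\<dots> \<simeq> letter a + tr (\<Sum>j=1..d. el (h j) * z ^ (i * j))"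
          unfolding a_def h_def
          by (intro cong_add tr_cong cong_sum cong_mult cong_sym[OF digit(2)] tr_base) (auto simp: rep(2))
        finally show ?thesis .
      qed
      then show ?thesis unfolding f(2) W_def shift_def prod.case
        by (intro restrict_ext digit_cong cong_add cong_refl)
    qed
    ultimately show "y \<in> W ` ({..<q} \<times> ({1..d} \<rightarrow>\<^sub>E {..n}))" by blast
  qed
  then have "card (block d x) \<le> card ({..<q} \<times> ({1..d} \<rightarrow>\<^sub>E {..n}))"
    by (intro surj_card_le finite_cartesian_product finite_PiE) auto
  then show ?thesis by (simp add: card_cartesian_product card_PiE q_m)
qed

text \<open>Surjectivity of the trace and interpolation give an \<open>f\<close> of degree at most
  \<open>card S - 1\<close> whose shift turns the pattern \<open>w\<close> into \<open>w'\<close>.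
  The shift is injective and preserves the block, so no pattern occurs more often than
  another.\<close>

lemma block_orthogonal_array:
  assumes x: "x \<in> words q n" and S: "S \<subseteq> {..<n}" "card S \<le> Suc d"
  shows "\<exists>l. \<forall>w \<in> S \<rightarrow>\<^sub>E {..<q}. card {y \<in> block d x. restrict y S = w} = l"
proof -
  have finS: "finite S" using S finite_subset by blast
  have le: "card {y \<in> block d x. restrict y S = w} \<le> card {y \<in> block d x. restrict y S = w'}"
    if w: "w \<in> S \<rightarrow>\<^sub>E {..<q}" "w' \<in> S \<rightarrow>\<^sub>E {..<q}" for w w'
  proof -
    have base: "letter (w' i) - letter (w i) \<in> base" if "i \<in> S" for i
      using that w by (intro base_diff letter_base) auto
    then have "\<forall>i\<in>S. \<exists>y. tr y \<simeq> letter (w' i) - letter (w i)"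
      using tr_surj by blast
    then obtain s where s: "\<And>i. i \<in> S \<Longrightarrow> tr (s i) \<simeq> letter (w' i) - letter (w i)"
      by metis
    obtain f where f: "degree f \<le> card S - 1" "\<And>i. i \<in> S \<Longrightarrow> poly f (z ^ i) \<simeq> s i"
      using interpolation[OF finS incong_on_subset[OF incong_z S(1)], of s] by auto
    have "shift f y \<in> {y \<in> block d x. restrict y S = w'}"
      if y: "y \<in> {y \<in> block d x. restrict y S = w}" for y
    proof -
      have yw: "y \<in> words q n" using y x block_subset by blast
      have "restrict (shift f y) S = w'"
      proof
        fix i
        show "restrict (shift f y) S i = w' i"
        proof (cases "i \<in> S")
          case True
          then have i: "i < n" and yi: "y i = w i" using S y by auto
          have "letter (shift f y i) \<simeq> letter (y i) + tr (poly f (z ^ i))" using yw i by (rule letter_shift)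
          also have "\<dots> \<simeq> letter (w i) + tr (s i)"
            using f(2)[OF True] yi by (intro cong_add tr_cong) auto
          also have "\<dots> \<simeq> letter (w i) + (letter (w' i) - letter (w i))"
            using s[OF True] by (intro cong_add) auto
          finally have "letter (shift f y i) \<simeq> letter (w' i)" by simp
          then have "shift f y i = w' i"
            using True w(2) i shift_words[OF yw, of f] by (intro incong_onD[OF incong_letter]) (auto simp: words_def)
          then show ?thesis using True by simp
        qed (use w in \<open>simp add: PiE_iff extensional_def\<close>)
      qed
      moreover have "shift f y \<in> block d x" using x y f(1) S(2) by (intro shift_block) auto
      ultimately show ?thesis by simp
    qed
    then show ?thesis
      using shift_inj block_subset[OF x, of d] finite_subset[OF block_subset[OF x] finite_words]
      by (intro card_inj_on_le[where f = "shift f"]) (auto intro: inj_on_subset[OF shift_inj])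
  qed
  show ?thesis
  proof (cases "S \<rightarrow>\<^sub>E {..<q} = {}")
    case False
    then show ?thesis using le by (meson all_not_in_conv dual_order.antisym)
  qed simp
qed

section \<open>Syndromes\<close>

definition syndrome :: "(nat \<Rightarrow> nat) \<Rightarrow> nat \<Rightarrow> 'a" where
  "syndrome x k = (\<Sum>i<n. letter (x i) * z ^ (i * k))"

lemma tr_poly: "tr (poly f (z ^ i)) \<simeq> (\<Sum>j\<le>degree f. \<Sum>l<m. coeff f j ^ (q ^ l) * z ^ (i * (j * q ^ l)))"
proof -
  have "tr (poly f (z ^ i)) = (\<Sum>l<m. (\<Sum>j\<le>degree f. coeff f j * z ^ (i * j)) ^ (q ^ l))"
    by (simp add: tr_def poly_altdef power_mult)
  also have "\<dots> \<simeq> (\<Sum>l<m. \<Sum>j\<le>degree f. (coeff f j * z ^ (i * j)) ^ (q ^ l))"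
    by (intro cong_sum power_q_sum)
  also have "\<dots> = (\<Sum>l<m. \<Sum>j\<le>degree f. coeff f j ^ (q ^ l) * z ^ (i * (j * q ^ l)))"
    by (simp add: power_mult_distrib mult.assoc flip: power_mult)
  also have "\<dots> = (\<Sum>j\<le>degree f. \<Sum>l<m. coeff f j ^ (q ^ l) * z ^ (i * (j * q ^ l)))"
    by (rule sum.swap)
  finally show ?thesis .
qed

text \<open>At most \<open>(q - 2) * q ^ (m - 1)\<close> comes from the first term. The remaining
  \<open>2 * q ^ (m - 1)\<close> in \<open>q ^ m\<close> is at least \<open>2 * q\<close>, because
  \<open>m\<close> is at least 2, and so exceeds \<open>k + 1\<close>.\<close>

lemma exponent_less:
  assumes "j + 2 \<le> q" "k < q" "l < m"
  shows "j * q ^ l + k < n"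
proof -
  have "q ^ l \<le> q ^ (m - 1)" using assms(3) q_gt by (intro power_increasing) auto
  then have "j * q ^ l \<le> (q - 2) * q ^ (m - 1)" using assms(1) by (intro mult_mono) auto
  moreover have "q ^ m = (q - 2) * q ^ (m - 1) + 2 * q ^ (m - 1)"
  proof -
    obtain t where t: "q = 2 + t" using le_Suc_ex[of 2 q] q_gt by auto
    have "q ^ m = q * q ^ (m - 1)" using m_gt by (cases m) auto
    also have "\<dots> = ((q - 2) + 2) * q ^ (m - 1)" using t by simp
    finally show ?thesis by (simp only: distrib_right)
  qed
  moreover have "q ^ 1 \<le> q ^ (m - 1)" using q_gt m_gt by (intro power_increasing) auto
  ultimately show ?thesis using assms q_m by simp
qed

text \<open>By \<open>tr_poly\<close> the difference of the two syndromes is a combination of power sums of the nonzero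
  field elements with exponents \<open>j q^l + k\<close>; these lie strictly between \<open>0\<close> and \<open>n\<close>.\<close>

lemma syndrome_shift:
  assumes x: "x \<in> words q n" and f: "degree f + 2 \<le> q" and k: "0 < k" "k < q"
  shows "syndrome (shift f x) k \<simeq> syndrome x k"
proof -
  let ?t = "\<lambda>i j l. coeff f j ^ (q ^ l) * z ^ (i * (j * q ^ l))"
  have "syndrome (shift f x) k \<simeq> (\<Sum>i<n. (letter (x i) + (\<Sum>j\<le>degree f. \<Sum>l<m. ?t i j l)) * z ^ (i * k))"
    unfolding syndrome_def
  proof (intro cong_sum cong_mult cong_refl)
    fix i assume "i \<in> {..<n}"
    then have "letter (shift f x i) \<simeq> letter (x i) + tr (poly f (z ^ i))"
      using x by (intro letter_shift) auto
    also have "\<dots> \<simeq> letter (x i) + (\<Sum>j\<le>degree f. \<Sum>l<m. ?t i j l)" by (intro cong_add tr_poly cong_refl)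
    finally show "letter (shift f x i) \<simeq> letter (x i) + (\<Sum>j\<le>degree f. \<Sum>l<m. ?t i j l)" .
  qed
  also have "\<dots> = syndrome x k + (\<Sum>i<n. \<Sum>j\<le>degree f. \<Sum>l<m. ?t i j l * z ^ (i * k))"
    by (simp add: syndrome_def distrib_right sum.distrib sum_distrib_right)
  also have "(\<Sum>i<n. \<Sum>j\<le>degree f. \<Sum>l<m. ?t i j l * z ^ (i * k)) =
      (\<Sum>j\<le>degree f. \<Sum>l<m. coeff f j ^ (q ^ l) * (\<Sum>i<n. z ^ (i * (j * q ^ l + k))))"
  proof -
    have "(\<Sum>i<n. \<Sum>j\<le>degree f. \<Sum>l<m. ?t i j l * z ^ (i * k)) =
        (\<Sum>j\<le>degree f. \<Sum>i<n. \<Sum>l<m. ?t i j l * z ^ (i * k))" by (rule sum.swap)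
    also have "\<dots> = (\<Sum>j\<le>degree f. \<Sum>l<m. \<Sum>i<n. ?t i j l * z ^ (i * k))"
      by (intro sum.cong refl sum.swap)
    also have "\<dots> = (\<Sum>j\<le>degree f. \<Sum>l<m. coeff f j ^ (q ^ l) * (\<Sum>i<n. z ^ (i * (j * q ^ l + k))))"
      by (simp add: sum_distrib_left mult.assoc distrib_left power_add)
    finally show ?thesis .
  qed
  also have "syndrome x k + \<dots> \<simeq> syndrome x k + (\<Sum>j\<le>degree f. \<Sum>l<m. coeff f j ^ (q ^ l) * 0)"
    using f k by (intro cong_add cong_refl cong_sum cong_mult sum_z_powers exponent_less) auto
  finally show ?thesis by simp
qed

text \<open>The Vandermonde argument: the coefficients of a polynomial that is 1 at one point of
  \<open>S\<close> and 0 at the others combine the vanishing syndromes of the difference so as to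
  isolate a single letter.\<close>

lemma syndrome_distance:
  assumes xy: "x \<in> words q n" "y \<in> words q n" and S: "S \<subseteq> {..<n}" "card S \<le> d"
    and syn: "\<And>k. 1 \<le> k \<Longrightarrow> k \<le> d \<Longrightarrow> syndrome x k \<simeq> syndrome y k"
    and agree: "\<forall>i\<in>{..<n} - S. x i = y i"
  shows "x = y"
proof (rule words_eqI[OF xy])
  fix i0 assume i0: "i0 < n"
  have finS: "finite S" using S finite_subset by blast
  show "letter (x i0) \<simeq> letter (y i0)"
  proof (cases "i0 \<in> S")
    case False
    then show ?thesis using agree i0 by simp
  next
    case True
    have "card S > 0" using True finS by (auto simp: card_gt_0_iff)
    define D where "D i = letter (x i) - letter (y i)" for i
    obtain f where f: "degree f \<le> card S - 1" "\<And>i. i \<in> S \<Longrightarrow> poly f (z ^ i) \<simeq> of_bool (i = i0)"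
      using interpolation[OF finS incong_on_subset[OF incong_z S(1)], of "\<lambda>i. of_bool (i = i0)"] by auto
    have zero: "(\<Sum>i\<in>S. D i * z ^ (i * k)) \<simeq> 0" if k: "1 \<le> k" "k \<le> d" for k
    proof -
      have "(\<Sum>i\<in>S. D i * z ^ (i * k)) = (\<Sum>i<n. D i * z ^ (i * k))"
        using S agree by (intro sum.mono_neutral_left) (auto simp: D_def)
      also have "\<dots> = syndrome x k - syndrome y k"
        by (simp add: D_def syndrome_def algebra_simps sum_subtractf)
      also have "\<dots> \<simeq> 0" using syn[OF k] by (simp add: cong_diff_iff)
      finally show ?thesis .
    qed
    \<comment> \<open>The extra factor \<open>z ^ i\<close> accounts for the syndromes starting at
      exponent 1: the coefficient of degree \<open>k\<close> meets the syndrome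
      \<open>Suc k\<close>, and \<open>Suc k\<close> is at most \<open>card S\<close>.\<close>
    have "D i0 * z ^ i0 = (\<Sum>i\<in>S. D i * z ^ i * of_bool (i = i0))"
      using True finS by (simp add: of_bool_def if_distrib cong: if_cong)
    also have "\<dots> \<simeq> (\<Sum>i\<in>S. D i * z ^ i * poly f (z ^ i))"
      by (intro cong_sum cong_mult cong_refl cong_sym[OF f(2)])
    also have "\<dots> = (\<Sum>i\<in>S. \<Sum>k\<le>degree f. coeff f k * (D i * z ^ (i * Suc k)))"
      by (simp add: poly_altdef sum_distrib_left mult_ac power_add flip: power_mult)
    also have "\<dots> = (\<Sum>k\<le>degree f. coeff f k * (\<Sum>i\<in>S. D i * z ^ (i * Suc k)))"
      unfolding sum_distrib_left by (rule sum.swap)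
    also have "\<dots> \<simeq> (\<Sum>k\<le>degree f. coeff f k * 0)"
      using f(1) S(2) \<open>card S > 0\<close> by (intro cong_sum cong_mult cong_refl zero) auto
    finally have "D i0 * z ^ i0 \<simeq> 0" by simp
    then have "D i0 \<simeq> 0" using cong_mult_0 z_not_0 by blast
    then show ?thesis by (simp add: D_def cong_diff_iff)
  qed
qed

text \<open>Any \<open>q ^ K\<close> of the blocks span a code, so one-sided bounds on the size of a block and of a fibre
  of the syndrome map suffice; no dimension has to be computed exactly.\<close>

lemma quantum_code_exists:
  assumes c: "2 \<le> c" "c \<le> q" and K: "n = K + 1 + m * (2 * c - 3)"
  shows "\<exists>Q. quantum_code q n K c Q"
proof -
  define key where "key x = (\<lambda>k\<in>{1..c-1}. rep (syndrome x k))" for x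
  define B where "B = {1..c-1} \<rightarrow>\<^sub>E {..n}"
  define C where "C s = {x \<in> words q n. key x = s}" for s
  have finB: "finite B" and cardB: "card B = (q ^ m) ^ (c - 1)"
    by (simp_all add: B_def finite_PiE card_PiE q_m)
  have key: "key ` words q n \<subseteq> B" using rep(1) by (auto simp: key_def B_def)
  \<comment> \<open>Pigeonhole principle: some fibre of \<open>key\<close> is at least of average
    size.\<close>
  have "\<exists>s\<in>B. q ^ n \<le> card (C s) * (q ^ m) ^ (c - 1)"
  proof (rule ccontr)
    assume *: "\<not> ?thesis"
    have "B \<noteq> {}" using cardB q_gt by fastforce
    have "q ^ n = card (words q n)" by (simp add: words_def card_PiE)
    also have "\<dots> = (\<Sum>s\<in>B. card (C s))"
      using sum.group[OF finite_words finB key, of "\<lambda>_. 1::nat"] by (simp add: C_def)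
    finally have "card B * q ^ n = (\<Sum>s\<in>B. card (C s) * (q ^ m) ^ (c - 1))"
      by (simp add: cardB sum_distrib_right mult.commute)
    also have "\<dots> < (\<Sum>s\<in>B. q ^ n)"
      using * finB \<open>B \<noteq> {}\<close> by (intro sum_strict_mono) auto
    finally show False by simp
  qed
  then obtain s where s: "q ^ n \<le> card (C s) * (q ^ m) ^ (c - 1)" by blast
  have C_words: "C s \<subseteq> words q n" by (auto simp: C_def)
  \<comment> \<open>Degree at most \<open>c - 2\<close> and exponents at most \<open>c - 1\<close>
    are within the range of \<open>syndrome_shift\<close>, because \<open>c \<le> q\<close>.\<close>
  have block_C: "block (c - 2) x \<subseteq> C s" if x: "x \<in> C s" for x
  proof
    fix y assume y: "y \<in> block (c - 2) x"
    then obtain f where f: "degree f \<le> c - 2" "y = shift f x" by (auto simp: block_def)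
    have "key y = key x" unfolding key_def f(2)
      using x f(1) c by (intro restrict_ext rep_cong syndrome_shift) (auto simp: C_def)
    then show "y \<in> C s" using x y block_subset by (auto simp: C_def)
  qed
  define \<B> where "\<B> = block (c - 2) ` C s"
  have fin\<B>: "finite \<B>" unfolding \<B>_def using finite_subset[OF C_words finite_words] by simp
  have "C s = \<Union>\<B>" unfolding \<B>_def using block_C block_self C_words by blast
  then have "card (C s) \<le> (\<Sum>D\<in>\<B>. card D)" using card_Union_le_sum_card[of \<B>] by simp
  also have "\<dots> \<le> (\<Sum>D\<in>\<B>. q * (q ^ m) ^ (c - 2))"
    using card_block_le C_words by (intro sum_mono) (auto simp: \<B>_def)
  finally have "card (C s) \<le> card \<B> * (q * (q ^ m) ^ (c - 2))" by simp
  with s have "q ^ n \<le> card \<B> * (q * (q ^ m) ^ (c - 2)) * (q ^ m) ^ (c - 1)"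
    by (meson le_trans mult_le_mono1)
  also have "\<dots> = card \<B> * q ^ (1 + m * (2 * c - 3))"
  proof -
    have "2 * c - 3 = (c - 2) + (c - 1)" using c by simp
    then show ?thesis by (simp only: power_add power_mult power_one_right add_mult_distrib2 mult.assoc)
  qed
  finally have "q ^ K * q ^ (1 + m * (2 * c - 3)) \<le> card \<B> * q ^ (1 + m * (2 * c - 3))"
    using K by (simp only: power_add[symmetric] add.assoc)
  then have "q ^ K \<le> card \<B>" using q_gt by simp
  then obtain \<D> where \<D>: "\<D> \<subseteq> \<B>" "card \<D> = q ^ K" by (meson obtain_subset_with_card_n)
  have rep\<D>: "\<exists>x\<in>C s. D = block (c - 2) x" if "D \<in> \<D>" for D using that \<D> by (auto simp: \<B>_def)
  have "quantum_code q n K c (qvec.span ((\<lambda>D x. of_bool (x \<in> D)) ` \<D>))"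
  proof (rule quantum_code_from_orthogonal_arrays)
    show "card \<D> = q ^ K" "q > 0" using \<D> q_gt by auto
    show "D \<subseteq> words q n" "D \<noteq> {}" if "D \<in> \<D>" for D
      using rep\<D>[OF that] C_words block_subset block_self by blast+
    show "disjoint \<D>"
    proof (rule disjointI)
      fix D E assume "D \<in> \<D>" "E \<in> \<D>" "D \<noteq> E"
      moreover from this obtain x y where "x \<in> C s" "D = block (c - 2) x" "y \<in> C s" "E = block (c - 2) y"
        using rep\<D> by blast
      ultimately show "D \<inter> E = {}" using C_words blocks_meet[of x y _ "c - 2"] by blast
    qed
    show "x = y" if xy: "x \<in> \<Union>\<D>" "y \<in> \<Union>\<D>"
      and S: "S \<subseteq> {..<n}" "card S < c" and agree: "\<forall>i\<in>{..<n} - S. x i = y i" for x y S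
    proof -
      have "x \<in> C s" "y \<in> C s" using xy rep\<D> block_C by blast+
      then have words: "x \<in> words q n" "y \<in> words q n" and key: "key x = key y"
        by (auto simp: C_def)
      have "syndrome x k \<simeq> syndrome y k" if "1 \<le> k" "k \<le> c - 1" for k
        using fun_cong[OF key, of k] that by (intro rep_eqD) (simp add: key_def)
      with S(2) show ?thesis
        by (intro syndrome_distance[OF words S(1) _ _ agree, of "c - 1"]) auto
    qed
    show "\<exists>l. \<forall>w \<in> S \<rightarrow>\<^sub>E {..<q}. card {y \<in> D. restrict y S = w} = l"
      if "D \<in> \<D>" "S \<subseteq> {..<n}" "card S < c" for D S
      using rep\<D>[OF that(1)] C_words that(2,3) c block_orthogonal_array[of _ S "c - 2"] by force
  qed
  then show ?thesis ..
qed

end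

text \<open>This makes the dimension exponent a natural number. Raising \<open>m\<close> by one at
  most doubles the left side and multiplies the right side by \<open>q\<close>, which is at least
  2.\<close>

lemma parity_check_count_less:
  fixes q m c :: nat
  assumes "2 \<le> m" "2 \<le> c" "c \<le> q"
  shows "1 + m * (2 * c - 3) < q ^ m"
  using assms(1)
proof (induction m rule: dec_induct)
  case base
  \<comment> \<open>With this substitution \<open>4 * q - 5 < q ^ 2\<close> reads
    \<open>4 * t + 3 < t ^ 2 + 4 * t + 4\<close>, free of truncated subtraction.\<close>
  obtain t where q: "q = t + 2" using assms by (metis add.commute le_Suc_ex le_trans)
  have "2 * (2 * c - 3) \<le> 2 * (2 * q - 3)" using assms by simp
  moreover have "1 + 2 * (2 * q - 3) < q ^ 2"
    unfolding q by (simp add: power2_eq_square algebra_simps)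
  ultimately show ?case by linarith
next
  case (step k)
  have "1 + Suc k * (2 * c - 3) \<le> 2 * (1 + k * (2 * c - 3))" using step by (cases k) auto
  also have "\<dots> < q * q ^ k" using step assms by (intro mult_le_less_imp_less) auto
  finally show ?case by simp
qed

theorem theorem4p3:
  fixes q m n c :: nat
  assumes "primepow q" and "q \<ge> 3" and "m \<ge> 2"
    and "n = q ^ m - 1"
    and "2 \<le> c" and "c \<le> q"
    and "(int c - 1) * int q + 1 < \<lfloor>real q ^ nat \<lceil>real m / 2\<rceil> - 1\<rfloor>"
  shows "\<exists>K Q. int K = int n - int m * (2 * int c - 3) - 1 \<and> quantum_code q n K c Q"
proof -
  obtain p r where pr: "prime p" "q = p ^ r"
    using assms(1) by (auto simp: primepow_def)
  have less: "1 + m * (2 * c - 3) < q ^ m" using assms by (intro parity_check_count_less)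
  have n: "n > 0" using less assms(4) by simp
  obtain M :: "int poly set" where M: "maximal_ideal M" "of_nat p \<in> M" "[:0, 1:] ^ n - 1 \<in> M"
    "\<And>i. 0 < i \<Longrightarrow> i < n \<Longrightarrow> (\<Sum>k<n. ([:0, 1:] ^ i) ^ k) \<in> M"
    using exists_cyclotomic_maximal_ideal[OF pr(1) n] by blast
  have qm: "q ^ m = Suc n" "q ^ m = p ^ (r * m)"
    using less assms(4) by (simp, simp add: pr(2) power_mult)
  have "of_nat (Suc n) \<in> M"
  proof -
    have "r > 0" using pr(2) assms(2) by (cases r) auto
    then have "p dvd Suc n" unfolding qm(1)[symmetric] qm(2) using assms(3) by simp
    then obtain b where "Suc n = b * p" by (auto simp: dvd_def mult.commute)
    then have "of_nat (Suc n) = of_nat b * (of_nat p :: int poly)" by (simp only: of_nat_mult)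
    then show ?thesis using maximal_ideal.mult_mem[OF M(1,2)] by simp
  qed
  then have prim: "[:0, 1:] ^ i - 1 \<notin> M" if "0 < i" "i < n" for i
    using maximal_ideal.not_cong_1_if_sum_powers[OF M(1) M(4)[OF that]] by blast
  interpret maximal_ideal M by fact
  interpret cyclotomic_quotient M p r m q n "[:0, 1:]"
  proof
    show "x ^ (q ^ m) - x \<in> M" for x
      unfolding qm(2)
    proof (rule int_poly_power_cong[OF M(1) pr(1) M(2)])
      \<comment> \<open>As \<open>q ^ m\<close> is \<open>Suc n\<close>, this product is the
        indeterminate raised to \<open>q ^ m\<close> minus the indeterminate.\<close>
      have "[:0, 1:] * ([:0, 1:] ^ n - 1) \<in> M" 
        using M(3) by (rule maximal_ideal.mult_mem[OF M(1)])
      then show "[:0, 1:] ^ (p ^ (r * m)) - [:0, 1:] \<in> M"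
        unfolding qm(2)[symmetric] qm(1) by (simp add: right_diff_distrib)
    qed
  qed (use pr assms M prim in auto)
  obtain K where K: "n = K + 1 + m * (2 * c - 3)"
    using less qm(1) by (metis add.commute add.left_commute le_Suc_ex less_Suc_eq_le)
  have "int K = int n - int m * (2 * int c - 3) - 1"
    using K assms(5) by (simp add: of_nat_diff)
  then show ?thesis using quantum_code_exists[OF assms(5,6) K] by blast
qed

end
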